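(* Let $\mathsf{T}$ be a triangulated category with shift functor $\Sigma$, let $(\mathsf{A},\mathsf{B})$ be a co-t-structure in $\mathsf{T}$, and let $\mathsf{C} = \Sigma^2\mathsf{A}\cap\mathsf{B}$ be its extended coheart. Then there is a bijection $$\{\text{co-t-structures } (\mathsf{A}',\mathsf{B}') \text{ in } \mathsf{T} \text{ with } \mathsf{A}\subseteq\mathsf{A}'\subseteq\Sigma\mathsf{A}\}\ \longleftrightarrow\ \{\text{complete cotorsion pairs } (\mathcal{X},\mathcal{Y}) \text{ in } \mathsf{C}\}$$ given by the mutually inverse assignments $$(\mathsf{A}',\mathsf{B}')\longmapsto(\mathsf{B}\cap\Sigma\mathsf{A}',\ \mathsf{B}'\cap\Sigma^2\mathsf{A}),\qquad (\mathcal{X},\mathcal{Y})\longmapsto\big(\mathsf{add}(\Sigma^{-1}\mathsf{A} * \Sigma^{-1}\mathcal{X}),\ \mathsf{add}(\mathcal{Y} * \Sigma^2\mathsf{B})\big).$$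
   Context: For subcategories $\mathsf{U},\mathsf{V}$ of a triangulated category $\mathsf{T}$, write $\mathsf{T}(u,v)=\mathrm{Hom}_{\mathsf{T}}(u,v)$, and let $\mathsf{U} * \mathsf{V}$ be the full subcategory of objects $t$ for which there is a distinguished triangle $u\to t\to v\to\Sigma u$ with $u\in\mathsf{U}$, $v\in\mathsf{V}$. For a subcategory $\mathsf{U}$, $\mathsf{add}(\mathsf{U})$ is the full subcategory of direct summands of finite direct sums of objects of $\mathsf{U}$. A co-t-structure in $\mathsf{T}$ is a pair $(\mathsf{A},\mathsf{B})$ of full subcategories closed under direct summands such that $\Sigma^{-1}\mathsf{A}\subseteq\mathsf{A}$, $\mathsf{T}(a,b)=0$ for all $a\in\mathsf{A}$, $b\in\mathsf{B}$, and $\mathsf{T}=\mathsf{A} * \mathsf{B}$. Its extended coheart is $\mathsf{C}=\Sigma^2\mathsf{A}\cap\mathsf{B}$. This is an extension-closed subcategory of $\mathsf{T}$, regarded as an extriangulated category with the structure induced from $\mathsf{T}$: $\mathbb{E}(c,a)=\mathsf{T}(c,\Sigma a)$ for $a,c\in\mathsf{C}$, and the $\mathbb{E}$-triangles $a\to b\to c$ are given by the distinguished triangles $a\to b\to c\to\Sigma a$ of $\mathsf{T}$ with $a,b,c\in\mathsf{C}$. A complete cotorsion pair in $\mathsf{C}$ is a pair $(\mathcal{X},\mathcal{Y})$ of full additive subcategories of $\mathsf{C}$ closed under direct summands such that: (1) $\mathbb{E}(x,y)=0$ for all $x\in\mathcal{X}$, $y\in\mathcal{Y}$; (2) for each $c\in\mathsf{C}$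 there is an $\mathbb{E}$-triangle $c\to y\to x$ with $x\in\mathcal{X}$, $y\in\mathcal{Y}$; (3) for each $c\in\mathsf{C}$ there is an $\mathbb{E}$-triangle $y\to x\to c$ with $x\in\mathcal{X}$, $y\in\mathcal{Y}$. *)

theory Defs
  imports "HOL-Algebra.Group"
begin

section \<open>Additive categories\<close>

text \<open>Hom-sets are not required to be disjoint: composition, addition and the action of the shift
  on morphisms are constrained only through membership in hom-sets. A full subcategory is given
  by its set of objects.\<close>

record ('o, 'm) category =
  Obj :: "'o set"
  Hom :: "'o \<Rightarrow> 'o \<Rightarrow> 'm set"
  Ide :: "'o \<Rightarrow> 'm"
  Cmp :: "'m \<Rightarrow> 'm \<Rightarrow> 'm" (infixl \<open>\<cdot>\<index>\<close> 70)

record ('o, 'm) preadditive_category = "('o, 'm) category" +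
  Add :: "'m \<Rightarrow> 'm \<Rightarrow> 'm"
  Zer :: "'o \<Rightarrow> 'o \<Rightarrow> 'm"

locale category =
  fixes T :: "('o, 'm, 'z) category_scheme" (structure)
  assumes Ide_closed: "a \<in> Obj T \<Longrightarrow> Ide T a \<in> Hom T a a"
    and Cmp_closed: "\<lbrakk>a \<in> Obj T; b \<in> Obj T; c \<in> Obj T; f \<in> Hom T a b; g \<in> Hom T b c\<rbrakk>
      \<Longrightarrow> g \<cdot> f \<in> Hom T a c"
    and Cmp_Ide: "\<lbrakk>a \<in> Obj T; b \<in> Obj T; f \<in> Hom T a b\<rbrakk> \<Longrightarrow> f \<cdot> Ide T a = f"
    and Ide_Cmp: "\<lbrakk>a \<in> Obj T; b \<in> Obj T; f \<in> Hom T a b\<rbrakk> \<Longrightarrow> Ide T b \<cdot> f = f"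
    and Cmp_assoc: "\<lbrakk>a \<in> Obj T; b \<in> Obj T; c \<in> Obj T; d \<in> Obj T;
        f \<in> Hom T a b; g \<in> Hom T b c; h \<in> Hom T c d\<rbrakk> \<Longrightarrow> (h \<cdot> g) \<cdot> f = h \<cdot> (g \<cdot> f)"

definition is_iso :: "('o, 'm, 'z) category_scheme \<Rightarrow> 'o \<Rightarrow> 'o \<Rightarrow> 'm \<Rightarrow> bool" where
  "is_iso T a b f \<longleftrightarrow> f \<in> Hom T a b \<and>
     (\<exists>g \<in> Hom T b a. g \<cdot>\<^bsub>T\<^esub> f = Ide T a \<and> f \<cdot>\<^bsub>T\<^esub> g = Ide T b)"

definition isomorphic :: "('o, 'm, 'z) category_scheme \<Rightarrow> 'o \<Rightarrow> 'o \<Rightarrow> bool" where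
  "isomorphic T a b \<longleftrightarrow> (\<exists>f. is_iso T a b f)"

definition zero_object :: "('o, 'm, 'z) category_scheme \<Rightarrow> 'o \<Rightarrow> bool" where
  "zero_object T z \<longleftrightarrow> z \<in> Obj T \<and>
     (\<forall>a \<in> Obj T. (\<exists>!f. f \<in> Hom T z a) \<and> (\<exists>!f. f \<in> Hom T a z))"

definition hom_group :: "('o, 'm, 'z) preadditive_category_scheme \<Rightarrow> 'o \<Rightarrow> 'o \<Rightarrow> 'm monoid" where
  "hom_group T a b = \<lparr>carrier = Hom T a b, monoid.mult = Add T, one = Zer T a b\<rparr>"

definition Neg :: "('o, 'm, 'z) preadditive_category_scheme \<Rightarrow> 'o \<Rightarrow> 'o \<Rightarrow> 'm \<Rightarrow> 'm" where
  "Neg T a b f = inv\<^bsub>hom_group T a b\<^esub> f"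

definition biproduct :: "('o, 'm, 'z) preadditive_category_scheme \<Rightarrow> 'o \<Rightarrow> 'o \<Rightarrow> 'o \<Rightarrow> bool" where
  "biproduct T a b s \<longleftrightarrow> a \<in> Obj T \<and> b \<in> Obj T \<and> s \<in> Obj T \<and>
     (\<exists>i \<in> Hom T a s. \<exists>j \<in> Hom T b s. \<exists>p \<in> Hom T s a. \<exists>q \<in> Hom T s b.
        p \<cdot>\<^bsub>T\<^esub> i = Ide T a \<and> q \<cdot>\<^bsub>T\<^esub> j = Ide T b \<and>
        p \<cdot>\<^bsub>T\<^esub> j = Zer T b a \<and> q \<cdot>\<^bsub>T\<^esub> i = Zer T a b \<and>
        Add T (i \<cdot>\<^bsub>T\<^esub> p) (j \<cdot>\<^bsub>T\<^esub> q) = Ide T s)"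

locale additive_category = category T
  for T :: "('o, 'm, 'z) preadditive_category_scheme" (structure) +
  assumes hom_comm_group: "\<lbrakk>a \<in> Obj T; b \<in> Obj T\<rbrakk> \<Longrightarrow> comm_group (hom_group T a b)"
    and Cmp_Add_left: "\<lbrakk>a \<in> Obj T; b \<in> Obj T; c \<in> Obj T; f \<in> Hom T a b; g \<in> Hom T b c; g' \<in> Hom T b c\<rbrakk>
      \<Longrightarrow> Add T g g' \<cdot> f = Add T (g \<cdot> f) (g' \<cdot> f)"
    and Cmp_Add_right: "\<lbrakk>a \<in> Obj T; b \<in> Obj T; c \<in> Obj T; f \<in> Hom T a b; f' \<in> Hom T a b; g \<in> Hom T b c\<rbrakk>
      \<Longrightarrow> g \<cdot> Add T f f' = Add T (g \<cdot> f) (g \<cdot> f')"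
    and ex_zero_object: "\<exists>z. zero_object T z"
    and ex_biproduct: "\<lbrakk>a \<in> Obj T; b \<in> Obj T\<rbrakk> \<Longrightarrow> \<exists>s. biproduct T a b s"


section \<open>Triangulated categories\<close>

text \<open>\<^term>\<open>Tri T a b c f g h\<close> says that \<open>a \<rightarrow> b \<rightarrow> c \<rightarrow> \<Sigma>a\<close>, with maps \<open>f\<close>, \<open>g\<close>, \<open>h\<close>,
  is a distinguished triangle.\<close>

record ('o, 'm) triangulated_category = "('o, 'm) preadditive_category" +
  ShO :: "'o \<Rightarrow> 'o"
  ShM :: "'m \<Rightarrow> 'm"
  Tri :: "'o \<Rightarrow> 'o \<Rightarrow> 'o \<Rightarrow> 'm \<Rightarrow> 'm \<Rightarrow> 'm \<Rightarrow> bool"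

definition triangle :: "('o, 'm, 'z) triangulated_category_scheme \<Rightarrow>
    'o \<Rightarrow> 'o \<Rightarrow> 'o \<Rightarrow> 'm \<Rightarrow> 'm \<Rightarrow> 'm \<Rightarrow> bool" where
  "triangle T a b c f g h \<longleftrightarrow> a \<in> Obj T \<and> b \<in> Obj T \<and> c \<in> Obj T \<and>
     f \<in> Hom T a b \<and> g \<in> Hom T b c \<and> h \<in> Hom T c (ShO T a)"

text \<open>The shift is an additive autoequivalence (fully faithful and essentially surjective);
  it need not be invertible on the nose.\<close>

locale triangulated_category = additive_category T
  for T :: "('o, 'm, 'z) triangulated_category_scheme" (structure) +
  assumes ShO_closed: "a \<in> Obj T \<Longrightarrow> ShO T a \<in> Obj T"
    and ShM_Ide: "a \<in> Obj T \<Longrightarrow> ShM T (Ide T a) = Ide T (ShO T a)"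
    and ShM_Cmp: "\<lbrakk>a \<in> Obj T; b \<in> Obj T; c \<in> Obj T; f \<in> Hom T a b; g \<in> Hom T b c\<rbrakk>
      \<Longrightarrow> ShM T (g \<cdot> f) = ShM T g \<cdot> ShM T f"
    and ShM_Add: "\<lbrakk>a \<in> Obj T; b \<in> Obj T; f \<in> Hom T a b; f' \<in> Hom T a b\<rbrakk>
      \<Longrightarrow> ShM T (Add T f f') = Add T (ShM T f) (ShM T f')"
    and ShM_bij: "\<lbrakk>a \<in> Obj T; b \<in> Obj T\<rbrakk>
      \<Longrightarrow> bij_betw (ShM T) (Hom T a b) (Hom T (ShO T a) (ShO T b))"
    and ShO_ess_surj: "b \<in> Obj T \<Longrightarrow> \<exists>a \<in> Obj T. isomorphic T (ShO T a) b"
    and Tri_triangle: "Tri T a b c f g h \<Longrightarrow> triangle T a b c f g h"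
    and TR1_iso: "\<lbrakk>Tri T a b c f g h; triangle T a' b' c' f' g' h';
        is_iso T a a' \<alpha>; is_iso T b b' \<beta>; is_iso T c c' \<gamma>;
        \<beta> \<cdot> f = f' \<cdot> \<alpha>; \<gamma> \<cdot> g = g' \<cdot> \<beta>; ShM T \<alpha> \<cdot> h = h' \<cdot> \<gamma>\<rbrakk> \<Longrightarrow> Tri T a' b' c' f' g' h'"
    and TR1_Ide: "\<lbrakk>a \<in> Obj T; zero_object T z\<rbrakk>
      \<Longrightarrow> Tri T a a z (Ide T a) (Zer T a z) (Zer T z (ShO T a))"
    and TR1_cone: "\<lbrakk>a \<in> Obj T; b \<in> Obj T; f \<in> Hom T a b\<rbrakk> \<Longrightarrow> \<exists>c g h. Tri T a b c f g h"
    and TR2: "triangle T a b c f g h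
      \<Longrightarrow> Tri T a b c f g h \<longleftrightarrow> Tri T b c (ShO T a) g h (Neg T (ShO T a) (ShO T b) (ShM T f))"
    and TR3: "\<lbrakk>Tri T a b c f g h; Tri T a' b' c' f' g' h';
        \<alpha> \<in> Hom T a a'; \<beta> \<in> Hom T b b'; \<beta> \<cdot> f = f' \<cdot> \<alpha>\<rbrakk>
      \<Longrightarrow> \<exists>\<gamma> \<in> Hom T c c'. \<gamma> \<cdot> g = g' \<cdot> \<beta> \<and> ShM T \<alpha> \<cdot> h = h' \<cdot> \<gamma>"
    and TR4: "\<lbrakk>Tri T a b d f f\<^sub>1 f\<^sub>2; Tri T b c e g g\<^sub>1 g\<^sub>2; Tri T a c k (g \<cdot> f) h\<^sub>1 h\<^sub>2\<rbrakk>
      \<Longrightarrow> \<exists>u v. Tri T d k e u v (ShM T f\<^sub>1 \<cdot> g\<^sub>2) \<and>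
            u \<cdot> f\<^sub>1 = h\<^sub>1 \<cdot> g \<and> h\<^sub>2 \<cdot> u = f\<^sub>2 \<and> v \<cdot> h\<^sub>1 = g\<^sub>1 \<and> g\<^sub>2 \<cdot> v = ShM T f \<cdot> h\<^sub>2"


section \<open>Full subcategories\<close>

text \<open>\<open>shift T U\<close> and \<open>unshift T U\<close> are \<open>\<Sigma>U\<close> and \<open>\<Sigma>\<^sup>-\<^sup>1U\<close>, closed under isomorphism
  because \<open>\<Sigma>\<close> is only an equivalence.\<close>

definition shift :: "('o, 'm, 'z) triangulated_category_scheme \<Rightarrow> 'o set \<Rightarrow> 'o set" where
  "shift T U = {t \<in> Obj T. \<exists>u \<in> U. isomorphic T t (ShO T u)}"

definition unshift :: "('o, 'm, 'z) triangulated_category_scheme \<Rightarrow> 'o set \<Rightarrow> 'o set" where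
  "unshift T U = {t \<in> Obj T. \<exists>u \<in> U. isomorphic T (ShO T t) u}"

definition star :: "('o, 'm, 'z) triangulated_category_scheme \<Rightarrow> 'o set \<Rightarrow> 'o set \<Rightarrow> 'o set" where
  "star T U V = {t \<in> Obj T. \<exists>u \<in> U. \<exists>v \<in> V. \<exists>f g h. Tri T u t v f g h}"

definition summand :: "('o, 'm, 'z) preadditive_category_scheme \<Rightarrow> 'o \<Rightarrow> 'o \<Rightarrow> bool" where
  "summand T t s \<longleftrightarrow> (\<exists>t'. biproduct T t t' s)"

inductive_set finite_sums :: "('o, 'm, 'z) preadditive_category_scheme \<Rightarrow> 'o set \<Rightarrow> 'o set"
  for T :: "('o, 'm, 'z) preadditive_category_scheme" and U :: "'o set" where
  empty: "zero_object T z \<Longrightarrow> z \<in> finite_sums T U"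
| insert: "\<lbrakk>x \<in> finite_sums T U; u \<in> U; biproduct T x u s\<rbrakk> \<Longrightarrow> s \<in> finite_sums T U"

definition add_closure :: "('o, 'm, 'z) preadditive_category_scheme \<Rightarrow> 'o set \<Rightarrow> 'o set" where
  "add_closure T U = {t. \<exists>s \<in> finite_sums T U. summand T t s}"

definition summand_closed_in ::
    "('o, 'm, 'z) preadditive_category_scheme \<Rightarrow> 'o set \<Rightarrow> 'o set \<Rightarrow> bool" where
  "summand_closed_in T D U \<longleftrightarrow> (\<forall>u \<in> U. \<forall>t \<in> D. summand T t u \<longrightarrow> t \<in> U)"

definition additive_subcategory ::
    "('o, 'm, 'z) preadditive_category_scheme \<Rightarrow> 'o set \<Rightarrow> bool" where
  "additive_subcategory T U \<longleftrightarrow> U \<subseteq> Obj T \<and> (\<exists>z \<in> U. zero_object T z) \<and>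
     (\<forall>x \<in> U. \<forall>y \<in> U. \<exists>s \<in> U. biproduct T x y s)"


section \<open>Co-t-structures and cotorsion pairs\<close>

definition co_t_structure ::
    "('o, 'm, 'z) triangulated_category_scheme \<Rightarrow> 'o set \<Rightarrow> 'o set \<Rightarrow> bool" where
  "co_t_structure T A B \<longleftrightarrow>
     A \<subseteq> Obj T \<and> B \<subseteq> Obj T \<and>
     summand_closed_in T (Obj T) A \<and> summand_closed_in T (Obj T) B \<and>
     unshift T A \<subseteq> A \<and>
     (\<forall>a \<in> A. \<forall>b \<in> B. Hom T a b = {Zer T a b}) \<and>
     star T A B = Obj T"

definition extended_coheart ::
    "('o, 'm, 'z) triangulated_category_scheme \<Rightarrow> 'o set \<Rightarrow> 'o set \<Rightarrow> 'o set" where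
  "extended_coheart T A B = shift T (shift T A) \<inter> B"

definition Ext :: "('o, 'm, 'z) triangulated_category_scheme \<Rightarrow> 'o \<Rightarrow> 'o \<Rightarrow> 'm set" where
  "Ext T c a = Hom T c (ShO T a)"

definition E_triangle ::
    "('o, 'm, 'z) triangulated_category_scheme \<Rightarrow> 'o set \<Rightarrow> 'o \<Rightarrow> 'o \<Rightarrow> 'o \<Rightarrow> bool" where
  "E_triangle T C a b c \<longleftrightarrow> a \<in> C \<and> b \<in> C \<and> c \<in> C \<and> (\<exists>f g h. Tri T a b c f g h)"

definition complete_cotorsion_pair ::
    "('o, 'm, 'z) triangulated_category_scheme \<Rightarrow> 'o set \<Rightarrow> 'o set \<Rightarrow> 'o set \<Rightarrow> bool" where
  "complete_cotorsion_pair T C X Y \<longleftrightarrow>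
     X \<subseteq> C \<and> Y \<subseteq> C \<and>
     additive_subcategory T X \<and> additive_subcategory T Y \<and>
     summand_closed_in T C X \<and> summand_closed_in T C Y \<and>
     (\<forall>x \<in> X. \<forall>y \<in> Y. Ext T x y = {Zer T x (ShO T y)}) \<and>
     (\<forall>c \<in> C. \<exists>x \<in> X. \<exists>y \<in> Y. E_triangle T C c y x) \<and>
     (\<forall>c \<in> C. \<exists>x \<in> X. \<exists>y \<in> Y. E_triangle T C y x c)"

end

theory Submission imports Defs
begin

text \<open>In a co-t-structure each half is the orthogonal of the other, because an object orthogonal to
  one half splits off the other term of its decomposition triangle; similarly each half of a cotorsion
  pair \<open>(X, Y)\<close> in the coheart is determined inside the coheart by the vanishing of
  extensions. Truncating with respect to \<open>(A, B)\<close> and \<open>(\<Sigma>\<^sup>2A, \<Sigma>\<^sup>2B)\<close> gives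
  \<open>\<Sigma>\<^sup>-\<^sup>1A * \<Sigma>\<^sup>-\<^sup>1X = \<^sup>\<bottom>(Y \<union> \<Sigma>B)\<close> and
  \<open>Y * \<Sigma>\<^sup>2B = (A \<union> \<Sigma>\<^sup>-\<^sup>1X)\<^sup>\<bottom>\<close>, which are already closed under sums and summands.
  Almost everything then reduces to the vanishing of Hom-sets along triangles; only the decomposition
  of an arbitrary object needs the octahedral axiom, applied twice.\<close>


section \<open>Additive categories\<close>

text \<open>The shift is only an equivalence, so \<open>\<Sigma>\<^sup>-\<^sup>1\<close> is no
  operation on objects: a desuspension of \<open>x\<close> is any \<open>w\<close> with
  \<open>\<Sigma>w\<close> isomorphic to \<open>x\<close>. Conditions on it are rewritten through
  the equivalence of Hom(\<open>w\<close>, \<open>z\<close>) = 0 with Hom(\<open>x\<close>,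
  \<open>\<Sigma>z\<close>) = 0, which also turns vanishing of extensions into plain Hom-vanishing.
  The bounds \<open>A \<subseteq> A' \<subseteq> \<Sigma>A\<close> amount to
  \<open>\<Sigma>B \<subseteq> B' \<subseteq> B\<close>. Taking \<open>\<Sigma>B\<close> and
  \<open>A\<close> as the fixed parts of the two orthogonals builds these bounds in. The
  decomposition of an object is harder because it asks for a new triangle and not for vanishing: a
  middle piece in the coheart has to be divided between the two halves, and this compares cones of
  composites.\<close>

context additive_category
begin

section \<open>Arithmetic in the hom-groups\<close>

lemma Zer_closed: "a \<in> Obj T \<Longrightarrow> b \<in> Obj T \<Longrightarrow> Zer T a b \<in> Hom T a b"
  using comm_group.axioms(2)[OF hom_comm_group, of a b] group.is_monoid monoid.one_closed
  by (fastforce simp: hom_group_def)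

lemma Add_closed:
  assumes "a \<in> Obj T" "b \<in> Obj T" "f \<in> Hom T a b" "g \<in> Hom T a b"
  shows "Add T f g \<in> Hom T a b"
proof -
  interpret comm_group "hom_group T a b" by (rule hom_comm_group[OF assms(1,2)])
  show ?thesis using m_closed assms(3,4) by (simp add: hom_group_def)
qed

lemma Add_Zer:
  assumes "a \<in> Obj T" "b \<in> Obj T" "f \<in> Hom T a b"
  shows "Add T f (Zer T a b) = f" "Add T (Zer T a b) f = f"
proof -
  interpret comm_group "hom_group T a b" by (rule hom_comm_group[OF assms(1,2)])
  show "Add T f (Zer T a b) = f" "Add T (Zer T a b) f = f"
    using r_one[of f] l_one[of f] assms(3) by (simp_all add: hom_group_def)
qed

lemma Add_assoc:
  assumes "a \<in> Obj T" "b \<in> Obj T" "f \<in> Hom T a b" "g \<in> Hom T a b" "h \<in> Hom T a b"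
  shows "Add T (Add T f g) h = Add T f (Add T g h)"
proof -
  interpret comm_group "hom_group T a b" by (rule hom_comm_group[OF assms(1,2)])
  show ?thesis using m_assoc[of f g h] assms(3-) by (simp add: hom_group_def)
qed

lemma Add_commute:
  assumes "a \<in> Obj T" "b \<in> Obj T" "f \<in> Hom T a b" "g \<in> Hom T a b"
  shows "Add T f g = Add T g f"
proof -
  interpret comm_group "hom_group T a b" by (rule hom_comm_group[OF assms(1,2)])
  show ?thesis using m_comm[of f g] assms(3-) by (simp add: hom_group_def)
qed

lemma Neg_closed:
  assumes "a \<in> Obj T" "b \<in> Obj T" "f \<in> Hom T a b"
  shows "Neg T a b f \<in> Hom T a b"
proof -
  interpret comm_group "hom_group T a b" by (rule hom_comm_group[OF assms(1,2)])
  show ?thesis using inv_closed[of f] assms(3) by (simp add: hom_group_def Neg_def)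
qed

lemma Add_Neg:
  assumes "a \<in> Obj T" "b \<in> Obj T" "f \<in> Hom T a b"
  shows "Add T f (Neg T a b f) = Zer T a b"
proof -
  interpret comm_group "hom_group T a b" by (rule hom_comm_group[OF assms(1,2)])
  show ?thesis using r_inv[of f] assms(3) by (simp add: hom_group_def Neg_def)
qed

lemma Neg_unique:
  assumes "a \<in> Obj T" "b \<in> Obj T" "f \<in> Hom T a b" "g \<in> Hom T a b" "Add T f g = Zer T a b"
  shows "g = Neg T a b f"
proof -
  interpret comm_group "hom_group T a b" by (rule hom_comm_group[OF assms(1,2)])
  show ?thesis using inv_unique'[of f g] m_comm[of f g] assms(3-)
    by (simp add: hom_group_def Neg_def)
qed

lemma Neg_Neg:
  assumes "a \<in> Obj T" "b \<in> Obj T" "f \<in> Hom T a b"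
  shows "Neg T a b (Neg T a b f) = f"
proof -
  interpret comm_group "hom_group T a b" by (rule hom_comm_group[OF assms(1,2)])
  show ?thesis using inv_inv[of f] assms(3) by (simp add: hom_group_def Neg_def)
qed

lemma Add_idem_imp_Zer:
  assumes "a \<in> Obj T" "b \<in> Obj T" "f \<in> Hom T a b" "Add T f f = f"
  shows "f = Zer T a b"
proof -
  interpret comm_group "hom_group T a b" by (rule hom_comm_group[OF assms(1,2)])
  show ?thesis using r_cancel_one[of f f] assms(3,4) by (simp add: hom_group_def)
qed

lemma eq_if_Add_Neg:
  assumes "a \<in> Obj T" "b \<in> Obj T" "f \<in> Hom T a b" "g \<in> Hom T a b"
    and "Add T f (Neg T a b g) = Zer T a b"
  shows "f = g"
  using assms Neg_unique Add_commute Neg_closed Neg_Neg by metis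

lemma Cmp_Zer_right:
  assumes "a \<in> Obj T" "b \<in> Obj T" "c \<in> Obj T" "g \<in> Hom T b c"
  shows "g \<cdot> Zer T a b = Zer T a c"
  using assms Cmp_Add_right[of a b c "Zer T a b" "Zer T a b" g]
  by (intro Add_idem_imp_Zer) (auto simp: Add_Zer Zer_closed intro: Cmp_closed)

lemma Cmp_Zer_left:
  assumes "a \<in> Obj T" "b \<in> Obj T" "c \<in> Obj T" "f \<in> Hom T a b"
  shows "Zer T b c \<cdot> f = Zer T a c"
  using assms Cmp_Add_left[of a b c f "Zer T b c" "Zer T b c"]
  by (intro Add_idem_imp_Zer) (auto simp: Add_Zer Zer_closed intro: Cmp_closed)

lemma Cmp_Neg_right:
  assumes "a \<in> Obj T" "b \<in> Obj T" "c \<in> Obj T" "f \<in> Hom T a b" "g \<in> Hom T b c"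
  shows "g \<cdot> Neg T a b f = Neg T a c (g \<cdot> f)"
  using assms Cmp_Add_right[of a b c f "Neg T a b f" g]
  by (intro Neg_unique) (auto simp: Add_Neg Cmp_Zer_right Neg_closed intro: Cmp_closed Neg_closed)

lemma Cmp_Neg_left:
  assumes "a \<in> Obj T" "b \<in> Obj T" "c \<in> Obj T" "f \<in> Hom T a b" "g \<in> Hom T b c"
  shows "Neg T b c g \<cdot> f = Neg T a c (g \<cdot> f)"
  using assms Cmp_Add_left[of a b c f g "Neg T b c g"]
  by (intro Neg_unique) (auto simp: Add_Neg Cmp_Zer_left Neg_closed intro: Cmp_closed Neg_closed)

lemma Cmp_cancel_right:
  assumes "a \<in> Obj T" "b \<in> Obj T" "a' \<in> Obj T" "f \<in> Hom T a b" "u \<in> Hom T a a'" "v \<in> Hom T a' a"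
    and "v \<cdot> u = Ide T a"
  shows "(f \<cdot> v) \<cdot> u = f"
  using assms Cmp_assoc[of a a' a b u v f] Cmp_Ide by auto

section \<open>Isomorphisms, vanishing Hom-sets and retracts\<close>

lemma isomorphicE:
  assumes "isomorphic T a b"
  obtains u v where "u \<in> Hom T a b" "v \<in> Hom T b a" "v \<cdot> u = Ide T a" "u \<cdot> v = Ide T b"
  using assms unfolding isomorphic_def is_iso_def by auto

lemma isomorphic_refl: "a \<in> Obj T \<Longrightarrow> isomorphic T a a"
  unfolding isomorphic_def is_iso_def using Ide_closed[of a] Cmp_Ide[of a a "Ide T a"] by auto

lemma isomorphic_sym: "isomorphic T a b \<Longrightarrow> isomorphic T b a"
  unfolding isomorphic_def is_iso_def by blast

definition orth :: "'o \<Rightarrow> 'o \<Rightarrow> bool" where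
  "orth a b \<longleftrightarrow> Hom T a b = {Zer T a b}"

lemma orthI:
  assumes "a \<in> Obj T" "b \<in> Obj T" "\<And>f. f \<in> Hom T a b \<Longrightarrow> f = Zer T a b"
  shows "orth a b"
  using assms Zer_closed unfolding orth_def by blast

lemma orthD: "orth a b \<Longrightarrow> f \<in> Hom T a b \<Longrightarrow> f = Zer T a b"
  unfolding orth_def by auto

text \<open>Weaker than \<open>summand\<close>, as no complement is required. Vanishing of Hom-sets
  passes to retracts in any additive category, whereas a complement is obtained only from a
  triangle, in \<open>retract_imp_summand\<close>.\<close>

definition retract :: "'o \<Rightarrow> 'o \<Rightarrow> bool" where
  "retract t s \<longleftrightarrow> (\<exists>i \<in> Hom T t s. \<exists>p \<in> Hom T s t. p \<cdot> i = Ide T t)"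

lemma isomorphic_imp_retract: "isomorphic T a b \<Longrightarrow> retract a b"
  by (meson isomorphicE retract_def)

lemma summand_imp_retract: "summand T t s \<Longrightarrow> retract t s"
  unfolding summand_def biproduct_def retract_def by blast

lemma summand_Obj: "summand T t s \<Longrightarrow> t \<in> Obj T \<and> s \<in> Obj T"
  unfolding summand_def biproduct_def by blast

lemma orth_retract_left:
  assumes "t \<in> Obj T" "s \<in> Obj T" "b \<in> Obj T" "retract t s" "orth s b"
  shows "orth t b"
proof (rule orthI)
  fix f assume f: "f \<in> Hom T t b"
  obtain i p where ip: "i \<in> Hom T t s" "p \<in> Hom T s t" "p \<cdot> i = Ide T t"
    using assms(4) unfolding retract_def by blast
  have "f \<cdot> p = Zer T s b" using assms ip f orthD Cmp_closed by blast
  then show "f = Zer T t b"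
    using Cmp_cancel_right[of t b s f i p] Cmp_Zer_left[of t s b i] ip f assms by simp
qed (use assms in auto)

lemma orth_retract_right:
  assumes "t \<in> Obj T" "s \<in> Obj T" "a \<in> Obj T" "retract t s" "orth a s"
  shows "orth a t"
proof (rule orthI)
  fix f assume f: "f \<in> Hom T a t"
  obtain i p where ip: "i \<in> Hom T t s" "p \<in> Hom T s t" "p \<cdot> i = Ide T t"
    using assms(4) unfolding retract_def by blast
  have "i \<cdot> f = Zer T a s" using assms ip f orthD Cmp_closed by blast
  then show "f = Zer T a t"
    using Cmp_assoc[of a t s t f i p] Ide_Cmp[of a t f] Cmp_Zer_right[of a s t p] ip f assms by simp
qed (use assms in auto)

lemma orth_iso:
  assumes "a \<in> Obj T" "b \<in> Obj T" "a' \<in> Obj T" "b' \<in> Obj T"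
    and "isomorphic T a a'" "isomorphic T b b'" "orth a' b'"
  shows "orth a b"
  using assms orth_retract_left orth_retract_right isomorphic_imp_retract by meson

lemma zero_object_orth:
  assumes "zero_object T z" "a \<in> Obj T"
  shows "orth z a" "orth a z"
  using assms Zer_closed by (auto simp: zero_object_def intro!: orthI)

text \<open>\<open>finite_sums\<close> starts from a zero object and \<open>summand\<close> asks for
  a complement, so these trivial decompositions are what places an object in its own additive
  closure.\<close>

lemma biproduct_zero:
  assumes "zero_object T z" "a \<in> Obj T"
  shows "biproduct T a z a" "biproduct T z a a"
proof -
  have z: "z \<in> Obj T" using assms by (simp add: zero_object_def)
  have zz: "Zer T z z = Ide T z"
    using orthD[OF zero_object_orth(1)[OF assms(1) z]] Ide_closed[OF z] by simp
  have *: "Ide T a \<in> Hom T a a" "Zer T a z \<in> Hom T a z" "Zer T z a \<in> Hom T z a"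
    "Zer T a a \<in> Hom T a a"
    using Ide_closed Zer_closed assms(2) z by auto
  have **: "Ide T a \<cdot> Ide T a = Ide T a" "Zer T a z \<cdot> Zer T z a = Ide T z"
    "Ide T a \<cdot> Zer T z a = Zer T z a" "Zer T a z \<cdot> Ide T a = Zer T a z"
    "Zer T z a \<cdot> Zer T a z = Zer T a a"
    using Cmp_Ide Ide_Cmp Cmp_Zer_right Cmp_Zer_left * z zz assms(2) by metis+
  show "biproduct T a z a" unfolding biproduct_def
    using assms z * ** Add_Zer[OF assms(2) assms(2) *(1)] by metis
  show "biproduct T z a a" unfolding biproduct_def
    using assms z * ** Add_Zer[OF assms(2) assms(2) *(1)] by metis
qed

lemma orth_biproduct_left:
  assumes "biproduct T a b s" "c \<in> Obj T" "orth a c" "orth b c"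
  shows "orth s c"
proof (rule orthI)
  fix f assume f: "f \<in> Hom T s c"
  obtain i j p q where o: "a \<in> Obj T" "b \<in> Obj T" "s \<in> Obj T"
    and ijpq: "i \<in> Hom T a s" "j \<in> Hom T b s" "p \<in> Hom T s a" "q \<in> Hom T s b"
    and id: "Add T (i \<cdot> p) (j \<cdot> q) = Ide T s"
    using assms(1) unfolding biproduct_def by blast
  have "f = Add T (f \<cdot> (i \<cdot> p)) (f \<cdot> (j \<cdot> q))"
    using id Cmp_Add_right[of s s c "i \<cdot> p" "j \<cdot> q" f] Cmp_Ide[of s c f] o ijpq f assms(2)
    by (simp add: Cmp_closed)
  also have "\<dots> = Add T ((f \<cdot> i) \<cdot> p) ((f \<cdot> j) \<cdot> q)"
    using Cmp_assoc[of s a s c p i f] Cmp_assoc[of s b s c q j f] o ijpq f assms(2) by simp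
  also have "f \<cdot> i = Zer T a c" using orthD[OF assms(3)] Cmp_closed o ijpq f assms(2) by blast
  also have "f \<cdot> j = Zer T b c" using orthD[OF assms(4)] Cmp_closed o ijpq f assms(2) by blast
  finally show "f = Zer T s c"
    using Cmp_Zer_left o ijpq assms(2) by (simp add: Add_Zer Zer_closed)
qed (use assms in \<open>auto simp: biproduct_def\<close>)

lemma orth_biproduct_right:
  assumes "biproduct T a b s" "c \<in> Obj T" "orth c a" "orth c b"
  shows "orth c s"
proof (rule orthI)
  fix f assume f: "f \<in> Hom T c s"
  obtain i j p q where o: "a \<in> Obj T" "b \<in> Obj T" "s \<in> Obj T"
    and ijpq: "i \<in> Hom T a s" "j \<in> Hom T b s" "p \<in> Hom T s a" "q \<in> Hom T s b"
    and id: "Add T (i \<cdot> p) (j \<cdot> q) = Ide T s"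
    using assms(1) unfolding biproduct_def by blast
  have "f = Add T ((i \<cdot> p) \<cdot> f) ((j \<cdot> q) \<cdot> f)"
    using id Cmp_Add_left[of c s s f "i \<cdot> p" "j \<cdot> q"] Ide_Cmp[of c s f] o ijpq f assms(2)
    by (simp add: Cmp_closed)
  also have "\<dots> = Add T (i \<cdot> (p \<cdot> f)) (j \<cdot> (q \<cdot> f))"
    using Cmp_assoc[of c s a s f p i] Cmp_assoc[of c s b s f q j] o ijpq f assms(2) by simp
  also have "p \<cdot> f = Zer T c a" using orthD[OF assms(3)] Cmp_closed o ijpq f assms(2) by blast
  also have "q \<cdot> f = Zer T c b" using orthD[OF assms(4)] Cmp_closed o ijpq f assms(2) by blast
  finally show "f = Zer T c s"
    using Cmp_Zer_right o ijpq assms(2) by (simp add: Add_Zer Zer_closed)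
qed (use assms in \<open>auto simp: biproduct_def\<close>)

section \<open>Orthogonal subcategories\<close>

definition lperp :: "'o set \<Rightarrow> 'o set" where
  "lperp U = {t \<in> Obj T. \<forall>u \<in> U. orth t u}"

definition rperp :: "'o set \<Rightarrow> 'o set" where
  "rperp U = {t \<in> Obj T. \<forall>u \<in> U. orth u t}"

lemma perp_retract:
  assumes "U \<subseteq> Obj T" "retract t s" "t \<in> Obj T"
  shows "s \<in> lperp U \<Longrightarrow> t \<in> lperp U" "s \<in> rperp U \<Longrightarrow> t \<in> rperp U"
  using assms orth_retract_left[of t s] orth_retract_right[of t s]
  unfolding lperp_def rperp_def by blast+

lemma perp_iso:
  assumes "U \<subseteq> Obj T" "isomorphic T t s" "t \<in> Obj T"
  shows "s \<in> lperp U \<Longrightarrow> t \<in> lperp U" "s \<in> rperp U \<Longrightarrow> t \<in> rperp U"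
  using perp_retract isomorphic_imp_retract assms by blast+

lemma perp_zero_object:
  assumes "U \<subseteq> Obj T" "zero_object T z"
  shows "z \<in> lperp U" "z \<in> rperp U"
proof -
  have "z \<in> Obj T" using assms(2) by (simp add: zero_object_def)
  then show "z \<in> lperp U" "z \<in> rperp U"
    using assms(1) zero_object_orth[OF assms(2)] by (auto simp: lperp_def rperp_def)
qed

lemma perp_biproduct:
  assumes "U \<subseteq> Obj T" "biproduct T a b s"
  shows "\<lbrakk>a \<in> lperp U; b \<in> lperp U\<rbrakk> \<Longrightarrow> s \<in> lperp U"
    "\<lbrakk>a \<in> rperp U; b \<in> rperp U\<rbrakk> \<Longrightarrow> s \<in> rperp U"
proof -
  have "s \<in> Obj T" using assms(2) by (simp add: biproduct_def)
  then show "\<lbrakk>a \<in> lperp U; b \<in> lperp U\<rbrakk> \<Longrightarrow> s \<in> lperp U"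
    "\<lbrakk>a \<in> rperp U; b \<in> rperp U\<rbrakk> \<Longrightarrow> s \<in> rperp U"
    using assms(1) orth_biproduct_left[OF assms(2)] orth_biproduct_right[OF assms(2)]
    by (auto simp: lperp_def rperp_def)
qed

lemma summand_closed_perp:
  assumes "U \<subseteq> Obj T"
  shows "summand_closed_in T (Obj T) (lperp U)" "summand_closed_in T (Obj T) (rperp U)"
  unfolding summand_closed_in_def using perp_retract[OF assms] summand_imp_retract by blast+

lemma subset_add_closure:
  assumes "U \<subseteq> Obj T"
  shows "U \<subseteq> add_closure T U"
proof
  fix u assume u: "u \<in> U"
  obtain z where z: "zero_object T z" using ex_zero_object by blast
  have "u \<in> finite_sums T U"
    using finite_sums.insert[OF finite_sums.empty[OF z] u] biproduct_zero(2)[OF z] u assms by blast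
  then show "u \<in> add_closure T U"
    using biproduct_zero(1)[OF z] u assms unfolding add_closure_def summand_def by blast
qed

lemma add_closure_lperp:
  assumes "U \<subseteq> Obj T" shows "add_closure T (lperp U) = lperp U"
proof
  have "s \<in> lperp U" if "s \<in> finite_sums T (lperp U)" for s
    using that
    by induction (use perp_zero_object[OF assms] perp_biproduct[OF assms] in blast)+
  then show "add_closure T (lperp U) \<subseteq> lperp U"
    using perp_retract[OF assms] summand_imp_retract summand_Obj unfolding add_closure_def by blast
qed (rule subset_add_closure, simp add: lperp_def)

lemma add_closure_rperp:
  assumes "U \<subseteq> Obj T" shows "add_closure T (rperp U) = rperp U"
proof
  have "s \<in> rperp U" if "s \<in> finite_sums T (rperp U)" for s
    using that
    by induction (use perp_zero_object[OF assms] perp_biproduct[OF assms] in blast)+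
  then show "add_closure T (rperp U) \<subseteq> rperp U"
    using perp_retract[OF assms] summand_imp_retract summand_Obj unfolding add_closure_def by blast
qed (rule subset_add_closure, simp add: rperp_def)

text \<open>Both halves of the cotorsion pair cut out by an intermediate co-t-structure have this
  shape, see \<open>X_eq\<close> and \<open>Y_eq\<close>.\<close>

lemma additive_subcategory_perp:
  assumes "U \<subseteq> Obj T" "V \<subseteq> Obj T"
  shows "additive_subcategory T (lperp U \<inter> rperp V)"
proof -
  have "\<exists>z \<in> lperp U \<inter> rperp V. zero_object T z"
    using ex_zero_object perp_zero_object assms by blast
  moreover have "\<exists>s \<in> lperp U \<inter> rperp V. biproduct T x y s"
    if "x \<in> lperp U \<inter> rperp V" "y \<in> lperp U \<inter> rperp V" for x y
  proof -
    have "x \<in> Obj T" "y \<in> Obj T" using that unfolding lperp_def by auto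
    then obtain s where "biproduct T x y s" using ex_biproduct by blast
    then show ?thesis using perp_biproduct assms that by blast
  qed
  ultimately show ?thesis unfolding additive_subcategory_def by (auto simp: lperp_def)
qed

end

section \<open>Triangulated categories\<close>

context triangulated_category
begin

section \<open>The shift as an equivalence\<close>

lemma ShM_closed: "\<lbrakk>a \<in> Obj T; b \<in> Obj T; f \<in> Hom T a b\<rbrakk> \<Longrightarrow> ShM T f \<in> Hom T (ShO T a) (ShO T b)"
  using ShM_bij bij_betwE by blast

lemma ShM_inj:
  "\<lbrakk>a \<in> Obj T; b \<in> Obj T; f \<in> Hom T a b; g \<in> Hom T a b; ShM T f = ShM T g\<rbrakk> \<Longrightarrow> f = g"
  using ShM_bij bij_betw_imp_inj_on inj_onD by metis

lemma ShM_surj: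
  assumes "a \<in> Obj T" "b \<in> Obj T" "g \<in> Hom T (ShO T a) (ShO T b)"
  obtains f where "f \<in> Hom T a b" "g = ShM T f"
  using ShM_bij[OF assms(1,2)] assms(3) unfolding bij_betw_def by blast

lemma ShM_Zer:
  assumes "a \<in> Obj T" "b \<in> Obj T"
  shows "ShM T (Zer T a b) = Zer T (ShO T a) (ShO T b)"
  using assms ShM_Add[of a b "Zer T a b" "Zer T a b"]
  by (intro Add_idem_imp_Zer) (auto simp: ShO_closed ShM_closed Zer_closed Add_Zer)

lemma orth_ShO:
  assumes "a \<in> Obj T" "b \<in> Obj T"
  shows "orth (ShO T a) (ShO T b) \<longleftrightarrow> orth a b"
proof
  assume *: "orth (ShO T a) (ShO T b)"
  show "orth a b"
  proof (rule orthI)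
    fix f assume f: "f \<in> Hom T a b"
    have "ShM T f = ShM T (Zer T a b)"
      using orthD[OF * ShM_closed[OF assms f]] ShM_Zer[OF assms] by simp
    then show "f = Zer T a b" using ShM_inj[OF assms f Zer_closed[OF assms]] by simp
  qed (use assms in auto)
next
  assume *: "orth a b"
  show "orth (ShO T a) (ShO T b)"
  proof (rule orthI)
    fix g assume "g \<in> Hom T (ShO T a) (ShO T b)"
    then obtain f where "f \<in> Hom T a b" "g = ShM T f" using ShM_surj assms by blast
    then show "g = Zer T (ShO T a) (ShO T b)" using orthD[OF *] ShM_Zer assms by blast
  qed (use assms ShO_closed in auto)
qed

lemma isomorphic_ShO:
  assumes "a \<in> Obj T" "b \<in> Obj T"
  shows "isomorphic T (ShO T a) (ShO T b) \<longleftrightarrow> isomorphic T a b"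
proof
  assume "isomorphic T (ShO T a) (ShO T b)"
  then obtain u v where 1: "u \<in> Hom T (ShO T a) (ShO T b)" "v \<in> Hom T (ShO T b) (ShO T a)"
    "v \<cdot> u = Ide T (ShO T a)" "u \<cdot> v = Ide T (ShO T b)" by (rule isomorphicE)
  obtain f where f: "f \<in> Hom T a b" "u = ShM T f" using ShM_surj assms 1 by blast
  obtain g where g: "g \<in> Hom T b a" "v = ShM T g" using ShM_surj assms 1 by blast
  have "g \<cdot> f = Ide T a"
    using ShM_inj[of a a "g \<cdot> f" "Ide T a"] ShM_Cmp[of a b a f g] f g 1 assms
    by (simp add: Cmp_closed[of a b a] Ide_closed ShM_Ide)
  moreover have "f \<cdot> g = Ide T b"
    using ShM_inj[of b b "f \<cdot> g" "Ide T b"] ShM_Cmp[of b a b g f] f g 1 assms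
    by (simp add: Cmp_closed[of b a b] Ide_closed ShM_Ide)
  ultimately show "isomorphic T a b" unfolding isomorphic_def is_iso_def using f g by blast
next
  assume "isomorphic T a b"
  then obtain u v where 1: "u \<in> Hom T a b" "v \<in> Hom T b a" "v \<cdot> u = Ide T a" "u \<cdot> v = Ide T b"
    by (rule isomorphicE)
  have "ShM T v \<cdot> ShM T u = Ide T (ShO T a)" "ShM T u \<cdot> ShM T v = Ide T (ShO T b)"
    using ShM_Cmp[of a b a u v] ShM_Cmp[of b a b v u] 1 assms ShM_Ide by auto
  then show "isomorphic T (ShO T a) (ShO T b)"
    unfolding isomorphic_def is_iso_def using ShM_closed 1 assms by blast
qed

section \<open>Rotation of triangles and exactness of Hom\<close>

lemma TriD:
  assumes "Tri T a b c f g h"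
  shows "a \<in> Obj T" "b \<in> Obj T" "c \<in> Obj T" "f \<in> Hom T a b" "g \<in> Hom T b c"
    "h \<in> Hom T c (ShO T a)"
  using Tri_triangle[OF assms] unfolding triangle_def by auto

lemma Tri_rotate:
  "Tri T a b c f g h \<Longrightarrow> Tri T b c (ShO T a) g h (Neg T (ShO T a) (ShO T b) (ShM T f))"
  using TR2 Tri_triangle by blast

text \<open>Transport of structure: \<open>TR1_iso\<close> only recognises a candidate that is
  already given, so the new maps are built by conjugation. Each object of a triangle can then be
  replaced by an isomorphic one.\<close>

lemma Tri_iso_exists:
  assumes "Tri T a b c f g h" "a' \<in> Obj T" "b' \<in> Obj T" "c' \<in> Obj T"
    and a: "\<alpha> \<in> Hom T a a'" "\<alpha>' \<in> Hom T a' a" "\<alpha>' \<cdot> \<alpha> = Ide T a" "\<alpha> \<cdot> \<alpha>' = Ide T a'"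
    and b: "\<beta> \<in> Hom T b b'" "\<beta>' \<in> Hom T b' b" "\<beta>' \<cdot> \<beta> = Ide T b" "\<beta> \<cdot> \<beta>' = Ide T b'"
    and c: "\<gamma> \<in> Hom T c c'" "\<gamma>' \<in> Hom T c' c" "\<gamma>' \<cdot> \<gamma> = Ide T c" "\<gamma> \<cdot> \<gamma>' = Ide T c'"
  shows "Tri T a' b' c' ((\<beta> \<cdot> f) \<cdot> \<alpha>') ((\<gamma> \<cdot> g) \<cdot> \<beta>') ((ShM T \<alpha> \<cdot> h) \<cdot> \<gamma>')"
proof -
  note t = TriD[OF assms(1)]
  have m: "\<beta> \<cdot> f \<in> Hom T a b'" "\<gamma> \<cdot> g \<in> Hom T b c'" "ShM T \<alpha> \<cdot> h \<in> Hom T c (ShO T a')"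
    using Cmp_closed ShM_closed ShO_closed t assms by meson+
  then have "(\<beta> \<cdot> f) \<cdot> \<alpha>' \<in> Hom T a' b'" "(\<gamma> \<cdot> g) \<cdot> \<beta>' \<in> Hom T b' c'"
    "(ShM T \<alpha> \<cdot> h) \<cdot> \<gamma>' \<in> Hom T c' (ShO T a')"
    using Cmp_closed ShO_closed t assms by meson+
  then have tr: "triangle T a' b' c' ((\<beta> \<cdot> f) \<cdot> \<alpha>') ((\<gamma> \<cdot> g) \<cdot> \<beta>') ((ShM T \<alpha> \<cdot> h) \<cdot> \<gamma>')"
    unfolding triangle_def using assms by blast
  have iso: "is_iso T a a' \<alpha>" "is_iso T b b' \<beta>" "is_iso T c c' \<gamma>"
    unfolding is_iso_def using a b c by blast+
  show ?thesis
  proof (rule TR1_iso[OF assms(1) tr iso])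
    show "\<beta> \<cdot> f = \<beta> \<cdot> f \<cdot> \<alpha>' \<cdot> \<alpha>"
      using Cmp_cancel_right[of a b' a' "\<beta> \<cdot> f" \<alpha> \<alpha>'] t m a assms(2-4) by simp
    show "\<gamma> \<cdot> g = \<gamma> \<cdot> g \<cdot> \<beta>' \<cdot> \<beta>"
      using Cmp_cancel_right[of b c' b' "\<gamma> \<cdot> g" \<beta> \<beta>'] t m b assms(2-4) by simp
    show "ShM T \<alpha> \<cdot> h = ShM T \<alpha> \<cdot> h \<cdot> \<gamma>' \<cdot> \<gamma>"
      using Cmp_cancel_right[of c "ShO T a'" c' "ShM T \<alpha> \<cdot> h" \<gamma> \<gamma>'] t m c assms(2-4) ShO_closed
      by simp
  qed
qed

text \<open>\<open>TR2\<close> goes backwards only when the third object is literally a shift, so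
  \<open>d\<close> is first replaced by an isomorphic \<open>ShO T a\<close>.\<close>

lemma Tri_unrotate:
  assumes "Tri T b c d g h k"
  obtains a f u v where "a \<in> Obj T" "u \<in> Hom T (ShO T a) d" "v \<in> Hom T d (ShO T a)"
    "v \<cdot> u = Ide T (ShO T a)" "u \<cdot> v = Ide T d" "Tri T a b c f g (v \<cdot> h)"
proof -
  note t = TriD[OF assms]
  obtain a where a: "a \<in> Obj T" "isomorphic T (ShO T a) d" using ShO_ess_surj t by blast
  obtain u v where uv: "u \<in> Hom T (ShO T a) d" "v \<in> Hom T d (ShO T a)"
    "v \<cdot> u = Ide T (ShO T a)" "u \<cdot> v = Ide T d" using a(2) by (rule isomorphicE)
  note o = t a ShO_closed[OF a(1)] ShO_closed[OF t(1)] ShO_closed[OF t(2)]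
  have ids: "Ide T x \<in> Hom T x x" "Ide T x \<cdot> Ide T x = Ide T x" if "x \<in> Obj T" for x
    using that Ide_closed Cmp_Ide by auto
  have vh: "v \<cdot> h \<in> Hom T c (ShO T a)" and ku: "k \<cdot> u \<in> Hom T (ShO T a) (ShO T b)"
    using Cmp_closed o uv by blast+
  have "Tri T b c (ShO T a) ((Ide T c \<cdot> g) \<cdot> Ide T b) ((v \<cdot> h) \<cdot> Ide T c)
     ((ShM T (Ide T b) \<cdot> k) \<cdot> u)"
    using o uv ids by (intro Tri_iso_exists[OF assms]) auto
  moreover have "(Ide T c \<cdot> g) \<cdot> Ide T b = g" "(v \<cdot> h) \<cdot> Ide T c = v \<cdot> h"
    "ShM T (Ide T b) \<cdot> k = k"
    using Ide_Cmp[of b c g] Cmp_Ide[of b c g] Cmp_Ide[OF _ _ vh] Ide_Cmp[of d "ShO T b" k] ShM_Ide o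
    by simp_all
  ultimately have tr: "Tri T b c (ShO T a) g (v \<cdot> h) (k \<cdot> u)" by simp
  \<comment> \<open>\<open>TR2\<close> puts a sign on the rotated map, hence \<open>f\<close> is a
    preimage of the negative of \<open>k \<cdot> u\<close>.\<close>
  obtain f where f: "f \<in> Hom T a b" "Neg T (ShO T a) (ShO T b) (k \<cdot> u) = ShM T f"
    using ShM_surj[of a b] Neg_closed[OF _ _ ku] o by metis
  then have "k \<cdot> u = Neg T (ShO T a) (ShO T b) (ShM T f)" using Neg_Neg[OF _ _ ku] o by metis
  then have "Tri T a b c f g (v \<cdot> h)"
    using TR2[of a b c f g "v \<cdot> h"] tr f vh o unfolding triangle_def by simp
  then show ?thesis using that a uv by blast
qed

text \<open>\<open>TR3\<close> maps the triangle \<open>a \<rightarrow> a \<rightarrow> 0\<close> to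
  the given one, and so \<open>g \<cdot> f\<close> factors through a zero object.\<close>

lemma Tri_Cmp_zero:
  assumes "Tri T a b c f g h"
  shows "g \<cdot> f = Zer T a c"
proof -
  note t = TriD[OF assms]
  obtain z where z: "zero_object T z" using ex_zero_object by blast
  then have zO: "z \<in> Obj T" by (simp add: zero_object_def)
  obtain \<gamma> where "\<gamma> \<in> Hom T z c" "\<gamma> \<cdot> Zer T a z = g \<cdot> f"
    using TR3[OF TR1_Ide[OF t(1) z] assms Ide_closed[OF t(1)] t(4)] by auto
  then show ?thesis using Cmp_Zer_right[of a z c \<gamma>] t zO by simp
qed

text \<open>Exactness of Hom(-, \<open>x\<close>) at \<open>b\<close>: \<open>TR3\<close> maps the
  given triangle to \<open>y \<rightarrow> x \<rightarrow> x\<close>, a backward rotation of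
  \<open>x \<rightarrow> x \<rightarrow> 0\<close>, and the third component is the
  factorisation.\<close>

lemma Tri_factor_contra:
  assumes "Tri T a b c f g h" "x \<in> Obj T" "\<phi> \<in> Hom T b x" "\<phi> \<cdot> f = Zer T a x"
  obtains \<psi> where "\<psi> \<in> Hom T c x" "\<psi> \<cdot> g = \<phi>"
proof -
  note t = TriD[OF assms(1)]
  obtain z where z: "zero_object T z" using ex_zero_object by blast
  obtain y f' k where y: "y \<in> Obj T" "Tri T y x x f' (Ide T x) k"
    using Tri_unrotate[OF TR1_Ide[OF assms(2) z]] by metis
  have "\<phi> \<cdot> f = f' \<cdot> Zer T a y"
    using assms Cmp_Zer_right[of a y x f'] TriD[OF y(2)] t by simp
  then obtain \<gamma> where "\<gamma> \<in> Hom T c x" "\<gamma> \<cdot> g = Ide T x \<cdot> \<phi>"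
    using TR3[OF assms(1) y(2) Zer_closed[OF t(1) y(1)] assms(3)] by blast
  then show ?thesis using that Ide_Cmp[of b x \<phi>] assms t by simp
qed

text \<open>Exactness of Hom(\<open>x\<close>, -) at \<open>b\<close>. Since \<open>TR3\<close> only
  fills in the third component, it is applied to rotated triangles, from
  \<open>x \<rightarrow> 0 \<rightarrow> \<Sigma>x\<close> to
  \<open>b \<rightarrow> c \<rightarrow> \<Sigma>a\<close>. The result is desuspended by fullness,
  and the signs on both sides cancel.\<close>

lemma Tri_factor_co:
  assumes "Tri T a b c f g h" "x \<in> Obj T" "\<phi> \<in> Hom T x b" "g \<cdot> \<phi> = Zer T x c"
  obtains \<psi> where "\<psi> \<in> Hom T x a" "f \<cdot> \<psi> = \<phi>"
proof -
  note t = TriD[OF assms(1)]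
  obtain z where z: "zero_object T z" using ex_zero_object by blast
  then have zO: "z \<in> Obj T" by (simp add: zero_object_def)
  note o = t assms zO ShO_closed[OF t(1)] ShO_closed[OF t(2)] ShO_closed[OF assms(2)]
  let ?N = "Neg T (ShO T x) (ShO T x) (Ide T (ShO T x))"
  have "Tri T x z (ShO T x) (Zer T x z) (Zer T z (ShO T x)) ?N"
    using Tri_rotate[OF TR1_Ide[OF assms(2) z]] ShM_Ide[OF assms(2)] by simp
  moreover have "Zer T z c \<cdot> Zer T x z = g \<cdot> \<phi>"
    using Cmp_Zer_left[of x z c "Zer T x z"] Zer_closed[of x z] o by simp
  ultimately obtain \<gamma> where \<gamma>: "\<gamma> \<in> Hom T (ShO T x) (ShO T a)"
    "ShM T \<phi> \<cdot> ?N = Neg T (ShO T a) (ShO T b) (ShM T f) \<cdot> \<gamma>"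
    using TR3[OF _ Tri_rotate[OF assms(1)], of x z "ShO T x" "Zer T x z" "Zer T z (ShO T x)" ?N
        \<phi> "Zer T z c"] Zer_closed[of z c] o by auto
  obtain \<psi> where \<psi>: "\<psi> \<in> Hom T x a" "\<gamma> = ShM T \<psi>" using ShM_surj \<gamma> o by blast
  have f\<psi>: "f \<cdot> \<psi> \<in> Hom T x b" using Cmp_closed \<psi> o by blast
  have "ShM T \<phi> \<cdot> ?N = Neg T (ShO T x) (ShO T b) (ShM T \<phi>)"
    using Cmp_Neg_right[of "ShO T x" "ShO T x" "ShO T b" "Ide T (ShO T x)" "ShM T \<phi>"]
      Cmp_Ide[of "ShO T x" "ShO T b" "ShM T \<phi>"] o Ide_closed ShM_closed by simp
  moreover have "Neg T (ShO T a) (ShO T b) (ShM T f) \<cdot> \<gamma> =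
      Neg T (ShO T x) (ShO T b) (ShM T (f \<cdot> \<psi>))"
    using Cmp_Neg_left[of "ShO T x" "ShO T a" "ShO T b" \<gamma> "ShM T f"] ShM_Cmp[of x a b \<psi> f]
      o ShM_closed \<gamma>(1) \<psi> by simp
  ultimately have "ShM T \<phi> = ShM T (f \<cdot> \<psi>)"
    using \<gamma>(2) Neg_Neg[of "ShO T x" "ShO T b"] o f\<psi> ShM_closed by metis
  then have "\<phi> = f \<cdot> \<psi>" using ShM_inj o f\<psi> by blast
  then show ?thesis using that \<psi> by simp
qed

text \<open>The cone of the section is a complement.\<close>

lemma retract_imp_summand:
  assumes x: "x \<in> Obj T" and b: "b \<in> Obj T" and "retract x b"
  shows "summand T x b"
proof -
  obtain g r where g: "g \<in> Hom T x b" and r: "r \<in> Hom T b x" and rg: "r \<cdot> g = Ide T x"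
    using assms(3) unfolding retract_def by blast
  obtain c h k where tri: "Tri T x b c g h k" using TR1_cone x b g by blast
  note t = TriD[OF tri]
  note o = x b t(3) ShO_closed[OF x] ShO_closed[OF b]
  note rot = Tri_rotate[OF tri]
  \<comment> \<open>\<open>ShM T g\<close> is a split monomorphism that kills \<open>k\<close>, so
    \<open>k\<close> is zero.\<close>
  have "ShM T r \<cdot> ShM T g = Ide T (ShO T x)" using ShM_Cmp[of x b x g r] rg g r o ShM_Ide by simp
  moreover have "ShM T g \<cdot> k = Zer T c (ShO T b)"
  proof -
    have "Neg T (ShO T x) (ShO T b) (ShM T g) \<cdot> k = Zer T c (ShO T b)"
      using Tri_Cmp_zero[OF Tri_rotate[OF tri]] Tri_Cmp_zero[OF Tri_rotate[OF rot]] by simp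
    then have "Neg T c (ShO T b) (ShM T g \<cdot> k) = Zer T c (ShO T b)"
      using Cmp_Neg_left[of c "ShO T x" "ShO T b" k "ShM T g"] t g o ShM_closed by simp
    moreover have "ShM T g \<cdot> k \<in> Hom T c (ShO T b)"
      using Cmp_closed[OF _ _ _ t(6) ShM_closed[OF x b g]] o by blast
    ultimately show ?thesis using Add_Neg[of c "ShO T b" "ShM T g \<cdot> k"] Add_Zer o by metis
  qed
  ultimately have "Ide T (ShO T x) \<cdot> k = ShM T r \<cdot> Zer T c (ShO T b)"
    using Cmp_assoc[of c "ShO T x" "ShO T b" "ShO T x" k "ShM T g" "ShM T r"] t g r o ShM_closed
    by simp
  then have k0: "k = Zer T c (ShO T x)"
    using Ide_Cmp[of c "ShO T x" k] Cmp_Zer_right[of c "ShO T b" "ShO T x" "ShM T r"] t r o ShM_closed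
    by simp
  \<comment> \<open>As \<open>k = 0\<close>, the map \<open>h\<close> is an epimorphism: a
    difference that kills \<open>h\<close> factors through \<open>k\<close>.\<close>
  have epi: "u = w" if y: "y \<in> Obj T" and "u \<in> Hom T c y" "w \<in> Hom T c y" "u \<cdot> h = w \<cdot> h" for u w y
  proof -
    let ?d = "Add T u (Neg T c y w)"
    have d: "?d \<in> Hom T c y" using that o by (intro Add_closed Neg_closed) auto
    have "?d \<cdot> h = Zer T b y"
      using Cmp_Add_left[of b c y h u "Neg T c y w"] Cmp_Neg_left[of b c y h w]
        Add_Neg[of b y "w \<cdot> h"] Neg_closed[of c y w] Cmp_closed[of b c y h w] that o t by simp
    then obtain \<psi> where "\<psi> \<in> Hom T (ShO T x) y" "\<psi> \<cdot> k = ?d"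
      using Tri_factor_contra[OF rot y d] by blast
    then have "?d = Zer T c y" using k0 Cmp_Zer_right[of c "ShO T x" y \<psi>] that o by simp
    then show ?thesis using eq_if_Add_Neg that o by blast
  qed
  have gr: "g \<cdot> r \<in> Hom T b b" using Cmp_closed g r o by blast
  have I: "Ide T b \<in> Hom T b b" using Ide_closed o by blast
  let ?n = "Neg T b b (g \<cdot> r)"
  \<comment> \<open>The idempotent complementary to \<open>g \<cdot> r\<close>. It kills
    \<open>g\<close>, so it factors through \<open>h\<close>, and the factor \<open>j\<close>
    includes the complement \<open>c\<close>. The remaining biproduct equations for \<open>j\<close>
    are checked after composing with \<open>h\<close> and cancelled by \<open>epi\<close>.\<close>
  let ?e = "Add T (Ide T b) ?n"
  have n: "?n \<in> Hom T b b" using Neg_closed gr o by blast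
  have e: "?e \<in> Hom T b b" using Add_closed I n o by blast
  have grg: "(g \<cdot> r) \<cdot> g = g" using Cmp_assoc[of x b x b g r g] rg Cmp_Ide[of x b g] g r o by simp
  have rgr: "r \<cdot> (g \<cdot> r) = r" using Cmp_assoc[of b x b x r g r] rg Ide_Cmp[of b x r] g r o by simp
  have "?e \<cdot> g = Zer T x b"
    using Cmp_Add_left[of x b b g "Ide T b" ?n] Cmp_Neg_left[of x b b g "g \<cdot> r"] grg
      Ide_Cmp[of x b g] Add_Neg[of x b g] I n g gr o by simp
  then obtain j where j: "j \<in> Hom T c b" "j \<cdot> h = ?e"
    using Tri_factor_contra[OF tri b e] by blast
  have hg: "h \<cdot> g = Zer T x c" by (rule Tri_Cmp_zero[OF tri])
  have hgr: "h \<cdot> (g \<cdot> r) = Zer T b c"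
    using Cmp_assoc[of b x b c r g h] hg Cmp_Zer_left[of b x c r] g r t o by simp
  have nz: "Neg T b y (Zer T b y) = Zer T b y" if "y \<in> Obj T" for y
    using that o Add_Neg Add_Zer Zer_closed Neg_closed by metis
  have "h \<cdot> ?e = h"
    using Cmp_Add_right[of b b c "Ide T b" ?n h] Cmp_Neg_right[of b b c "g \<cdot> r" h] hgr nz[of c]
      Cmp_Ide[of b c h] Add_Zer[of b c h] I n gr t o by simp
  then have "(h \<cdot> j) \<cdot> h = Ide T c \<cdot> h"
    using Cmp_assoc[of b c b c h j h] Ide_Cmp[of b c h] j t o by simp
  then have hj: "h \<cdot> j = Ide T c"
    using epi[of c "h \<cdot> j" "Ide T c"] Cmp_closed[of c b c j h] Ide_closed j t o by simp
  have "r \<cdot> ?e = Zer T b x"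
    using Cmp_Add_right[of b b x "Ide T b" ?n r] Cmp_Neg_right[of b b x "g \<cdot> r" r] rgr
      Cmp_Ide[of b x r] Add_Neg[of b x r] I n gr r o by simp
  then have "(r \<cdot> j) \<cdot> h = Zer T c x \<cdot> h"
    using Cmp_assoc[of b c b x h j r] Cmp_Zer_left[of b c x h] j r t o by simp
  then have rj: "r \<cdot> j = Zer T c x"
    using epi[of x "r \<cdot> j" "Zer T c x"] Cmp_closed[of c b x j r] Zer_closed j r t o by simp
  have "Add T (g \<cdot> r) (j \<cdot> h) = Add T ?e (g \<cdot> r)"
    using Add_commute[of b b "g \<cdot> r" ?e] gr e j o by simp
  also have "\<dots> = Ide T b"
    using Add_assoc[of b b "Ide T b" ?n "g \<cdot> r"] Add_commute[of b b ?n "g \<cdot> r"]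
      Add_Neg[of b b "g \<cdot> r"] Add_Zer[of b b "Ide T b"] I n gr o by simp
  finally have "biproduct T x c b" unfolding biproduct_def
    using o g r j(1) t(5) rg hj rj hg by blast
  then show ?thesis unfolding summand_def by blast
qed

section \<open>Triangles without their maps\<close>

text \<open>Vanishing of Hom-sets does not depend on the maps of a triangle, so the later arguments
  keep only its objects.\<close>

definition tri :: "'o \<Rightarrow> 'o \<Rightarrow> 'o \<Rightarrow> bool" where
  "tri a b c \<longleftrightarrow> (\<exists>f g h. Tri T a b c f g h)"

lemma tri_Obj: "tri a b c \<Longrightarrow> a \<in> Obj T \<and> b \<in> Obj T \<and> c \<in> Obj T"
  unfolding tri_def using TriD by blast

lemma tri_rotate: "tri a b c \<Longrightarrow> tri b c (ShO T a)"
  unfolding tri_def using Tri_rotate by blast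

lemma tri_unrotate:
  assumes "tri b c d"
  obtains a where "a \<in> Obj T" "isomorphic T (ShO T a) d" "tri a b c"
proof -
  obtain g h k where "Tri T b c d g h k" using assms unfolding tri_def by blast
  then obtain a f u v where *: "a \<in> Obj T" "u \<in> Hom T (ShO T a) d" "v \<in> Hom T d (ShO T a)"
    "v \<cdot> u = Ide T (ShO T a)" "u \<cdot> v = Ide T d" "Tri T a b c f g (v \<cdot> h)"
    by (rule Tri_unrotate)
  show ?thesis
    by (rule that[of a]) (use * in \<open>auto simp: isomorphic_def is_iso_def tri_def\<close>)
qed

lemma tri_iso:
  assumes "tri a b c" "a' \<in> Obj T" "b' \<in> Obj T" "c' \<in> Obj T"
    and "isomorphic T a a'" "isomorphic T b b'" "isomorphic T c c'"
  shows "tri a' b' c'"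
proof -
  obtain f g h where tr: "Tri T a b c f g h" using assms(1) unfolding tri_def by blast
  obtain \<alpha> \<alpha>' where a: "\<alpha> \<in> Hom T a a'" "\<alpha>' \<in> Hom T a' a" "\<alpha>' \<cdot> \<alpha> = Ide T a" "\<alpha> \<cdot> \<alpha>' = Ide T a'"
    using assms(5) by (rule isomorphicE)
  obtain \<beta> \<beta>' where b: "\<beta> \<in> Hom T b b'" "\<beta>' \<in> Hom T b' b" "\<beta>' \<cdot> \<beta> = Ide T b" "\<beta> \<cdot> \<beta>' = Ide T b'"
    using assms(6) by (rule isomorphicE)
  obtain \<gamma> \<gamma>' where c: "\<gamma> \<in> Hom T c c'" "\<gamma>' \<in> Hom T c' c" "\<gamma>' \<cdot> \<gamma> = Ide T c" "\<gamma> \<cdot> \<gamma>' = Ide T c'"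
    using assms(7) by (rule isomorphicE)
  show ?thesis unfolding tri_def using Tri_iso_exists[OF tr assms(2-4) a b c] by blast
qed

text \<open>Three rotations; the signs they introduce are invisible to \<open>tri\<close>.\<close>

lemma tri_shift:
  assumes "tri a b c"
  shows "tri (ShO T a) (ShO T b) (ShO T c)"
  using assms tri_rotate by blast

lemma tri_unshift:
  assumes "tri a (ShO T t) b" "t \<in> Obj T"
  obtains a' b' where "a' \<in> Obj T" "b' \<in> Obj T" "isomorphic T (ShO T a') a"
    "isomorphic T (ShO T b') b" "tri a' t b'"
proof -
  obtain b' where b': "b' \<in> Obj T" "isomorphic T (ShO T b') b" "tri b' a (ShO T t)"
    using tri_unrotate assms(1) by blast
  obtain t' where t': "t' \<in> Obj T" "isomorphic T (ShO T t') (ShO T t)" "tri t' b' a"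
    using tri_unrotate b'(3) by blast
  have a: "a \<in> Obj T" using assms tri_Obj by blast
  \<comment> \<open>The backward rotations produce only some \<open>t'\<close> with a shift
    isomorphic to that of \<open>t\<close>; since the shift reflects isomorphism, \<open>t\<close>
    itself can take its place.\<close>
  have "tri t b' a"
    using tri_iso[OF t'(3) assms(2) b'(1) a] t' isomorphic_ShO assms(2) isomorphic_refl b' a by blast
  then obtain a' where "a' \<in> Obj T" "isomorphic T (ShO T a') a" "tri a' t b'"
    using tri_unrotate by blast
  then show ?thesis using that b' by blast
qed

lemma orth_extension:
  assumes "tri a b c" "x \<in> Obj T"
  shows "\<lbrakk>orth a x; orth c x\<rbrakk> \<Longrightarrow> orth b x" "\<lbrakk>orth x a; orth x c\<rbrakk> \<Longrightarrow> orth x b"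
proof -
  obtain f g h where tr: "Tri T a b c f g h" using assms(1) unfolding tri_def by blast
  note t = TriD[OF tr]
  show "orth b x" if ax: "orth a x" and cx: "orth c x"
  proof (rule orthI)
    fix u assume u: "u \<in> Hom T b x"
    have "u \<cdot> f = Zer T a x" using orthD[OF ax] Cmp_closed[of a b x f u] u t assms by blast
    then obtain v where v: "v \<in> Hom T c x" "v \<cdot> g = u" using Tri_factor_contra[OF tr assms(2) u] by blast
    then show "u = Zer T b x" using orthD[OF cx v(1)] Cmp_Zer_left[of b c x g] t assms by simp
  qed (use assms t in auto)
  show "orth x b" if xa: "orth x a" and xc: "orth x c"
  proof (rule orthI)
    fix u assume u: "u \<in> Hom T x b"
    have "g \<cdot> u = Zer T x c" using orthD[OF xc] Cmp_closed[of x b c u g] u t assms by blast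
    then obtain v where v: "v \<in> Hom T x a" "f \<cdot> v = u" using Tri_factor_co[OF tr assms(2) u] by blast
    then show "u = Zer T x b" using orthD[OF xa v(1)] Cmp_Zer_right[of x a b f] t assms by simp
  qed (use assms t in auto)
qed

text \<open>The outer terms of a triangle are themselves extensions: \<open>c\<close> of
  \<open>\<Sigma>a\<close> by \<open>b\<close>, and \<open>a\<close> of \<open>b\<close> by a
  desuspension of \<open>c\<close>. Shifting \<open>x\<close> in the second part avoids naming that
  desuspension.\<close>

lemma orth_extension_ShO:
  assumes "tri a b c" "x \<in> Obj T"
  shows "\<lbrakk>orth b x; orth (ShO T a) x\<rbrakk> \<Longrightarrow> orth c x"
    "\<lbrakk>orth x b; orth (ShO T x) c\<rbrakk> \<Longrightarrow> orth x a"
proof -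
  show "orth c x" if "orth b x" "orth (ShO T a) x"
    using orth_extension(1)[OF tri_rotate[OF assms(1)] assms(2)] that by blast
  show "orth x a" if "orth x b" "orth (ShO T x) c"
  proof -
    obtain c' where c': "c' \<in> Obj T" "isomorphic T (ShO T c') c" "tri c' a b"
      using tri_unrotate assms(1) by blast
    have "orth (ShO T x) (ShO T c')"
      using orth_iso[of "ShO T x" "ShO T c'" "ShO T x" c] that(2) c' assms ShO_closed tri_Obj
        isomorphic_refl by blast
    then show ?thesis using orth_extension(2)[OF c'(3) assms(2)] orth_ShO c' assms that by blast
  qed
qed

lemma perp_extension:
  assumes "U \<subseteq> Obj T" "tri a b c"
  shows "\<lbrakk>a \<in> lperp U; c \<in> lperp U\<rbrakk> \<Longrightarrow> b \<in> lperp U" "\<lbrakk>a \<in> rperp U; c \<in> rperp U\<rbrakk> \<Longrightarrow> b \<in> rperp U"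
  using assms(1) orth_extension[OF assms(2)] tri_Obj[OF assms(2)] by (auto simp: lperp_def rperp_def)

text \<open>If the map into or out of \<open>x\<close> is zero, exactness factors the identity of
  \<open>x\<close> through the other map, so \<open>x\<close> is a retract. Every passage from
  orthogonality to membership in a summand-closed class rests on this splitting.\<close>

lemma tri_orth_summand:
  assumes "tri a x b"
  shows "orth a x \<Longrightarrow> summand T x b" "orth x b \<Longrightarrow> summand T x a"
proof -
  obtain f g h where tr: "Tri T a x b f g h" using assms(1) unfolding tri_def by blast
  note t = TriD[OF tr]
  note I = Ide_closed[OF t(2)]
  show "summand T x b" if "orth a x"
  proof -
    have "Ide T x \<cdot> f = Zer T a x" using Ide_Cmp[OF t(1,2,4)] orthD[OF that t(4)] by simp
    then obtain r where "r \<in> Hom T b x" "r \<cdot> g = Ide T x" using Tri_factor_contra[OF tr t(2) I] by blast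
    then show ?thesis using retract_imp_summand t unfolding retract_def by blast
  qed
  show "summand T x a" if "orth x b"
  proof -
    have "g \<cdot> Ide T x = Zer T x b" using Cmp_Ide[OF t(2,3,5)] orthD[OF that t(5)] by simp
    then obtain r where "r \<in> Hom T x a" "f \<cdot> r = Ide T x" using Tri_factor_co[OF tr t(2) I] by blast
    then show ?thesis using retract_imp_summand t unfolding retract_def by blast
  qed
qed

text \<open>The fibre of \<open>t \<rightarrow> b \<rightarrow> v\<close> is an extension of the two fibres; here all fibres are replaced
  by their shifts.\<close>

lemma octahedron_fibres:
  assumes "tri a t b" "tri b v x"
  obtains k where "tri t v k" "tri (ShO T a) k x"
proof -
  obtain f g h where "Tri T a t b f g h" using assms(1) unfolding tri_def by blast
  \<comment> \<open>\<open>TR4\<close> speaks of cones, and the cone of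
    \<open>t \<rightarrow> b\<close> is \<open>\<Sigma>a\<close>.\<close>
  note 1 = Tri_rotate[OF this]
  obtain p q r where 2: "Tri T b v x p q r" using assms(2) unfolding tri_def by blast
  have "p \<cdot> g \<in> Hom T t v" using Cmp_closed TriD[OF 1] TriD[OF 2] by blast
  then obtain k m n where 3: "Tri T t v k (p \<cdot> g) m n"
    using TR1_cone TriD[OF 1] TriD[OF 2] by blast
  show ?thesis by (rule that[of k]) (use TR4[OF 1 2 3] 3 in \<open>auto simp: tri_def\<close>)
qed

text \<open>Cobase change: \<open>v\<close> is a homotopy pushout of
  \<open>c \<rightarrow> y\<close> and \<open>c \<rightarrow> b\<close>, and opposite sides have the
  same cone. \<open>TR4\<close> is applied to the composite
  \<open>w \<rightarrow> c \<rightarrow> b\<close> with \<open>w\<close> a desuspension of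
  \<open>x\<close>; the three cones are \<open>y\<close>, \<open>r\<close> and
  \<open>v\<close>.\<close>

lemma octahedron_pushout:
  assumes "tri c y x" "tri c b r"
  obtains v where "tri b v x" "tri y v r"
proof -
  obtain w where w: "w \<in> Obj T" "isomorphic T (ShO T w) x" "tri w c y"
    using tri_unrotate assms(1) by blast
  obtain f g h where 1: "Tri T w c y f g h" using w(3) unfolding tri_def by blast
  obtain p q s where 2: "Tri T c b r p q s" using assms(2) unfolding tri_def by blast
  have "p \<cdot> f \<in> Hom T w b" using Cmp_closed TriD[OF 1] TriD[OF 2] by blast
  then obtain v m n where 3: "Tri T w b v (p \<cdot> f) m n"
    using TR1_cone TriD[OF 1] TriD[OF 2] by blast
  have "tri y v r" unfolding tri_def using TR4[OF 1 2 3] by blast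
  moreover have "tri w b v" using 3 unfolding tri_def by blast
  then have "tri b v x"
    using tri_iso[OF tri_rotate] w isomorphic_refl tri_Obj assms by meson
  ultimately show ?thesis using that by blast
qed

section \<open>Shifts of subcategories and the orthogonal form of co-t-structures\<close>

lemma shift_Obj: "shift T U \<subseteq> Obj T" unfolding shift_def by blast

lemma unshift_Obj: "unshift T U \<subseteq> Obj T" unfolding unshift_def by blast

lemma shift_mono: "U \<subseteq> V \<Longrightarrow> shift T U \<subseteq> shift T V" unfolding shift_def by blast

lemma ShO_in_shift: "u \<in> U \<Longrightarrow> u \<in> Obj T \<Longrightarrow> ShO T u \<in> shift T U"
  unfolding shift_def using isomorphic_refl ShO_closed by blast

lemma star_iff: "t \<in> star T U V \<longleftrightarrow> (\<exists>u \<in> U. \<exists>v \<in> V. tri u t v)"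
  unfolding star_def tri_def using TriD by blast

text \<open>\<open>shift\<close> also contains all isomorphic copies, but vanishing need only be
  tested on the objects \<open>ShO T u\<close>.\<close>

lemma orth_shift_right:
  assumes "U \<subseteq> Obj T" "x \<in> Obj T"
  shows "(\<forall>s \<in> shift T U. orth x s) \<longleftrightarrow> (\<forall>u \<in> U. orth x (ShO T u))"
proof
  show "\<forall>u \<in> U. orth x (ShO T u)" if "\<forall>s \<in> shift T U. orth x s"
    using that ShO_in_shift assms by blast
next
  assume *: "\<forall>u \<in> U. orth x (ShO T u)"
  show "\<forall>s \<in> shift T U. orth x s"
  proof
    fix s assume "s \<in> shift T U"
    then obtain u where u: "s \<in> Obj T" "u \<in> U" "isomorphic T s (ShO T u)"
      unfolding shift_def by blast
    show "orth x s"
      by (rule orth_iso[of x s x "ShO T u"])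
         (use u * assms isomorphic_refl ShO_closed in auto)
  qed
qed

lemma shift_lperp:
  assumes "U \<subseteq> Obj T"
  shows "shift T (lperp U) = lperp (shift T U)"
proof (intro Set.set_eqI iffI)
  fix t assume "t \<in> shift T (lperp U)"
  then obtain a where a: "t \<in> Obj T" "a \<in> lperp U" "isomorphic T t (ShO T a)"
    unfolding shift_def by blast
  have aO: "a \<in> Obj T" using a unfolding lperp_def by blast
  have "orth t (ShO T u)" if "u \<in> U" for u
    by (rule orth_iso[of t "ShO T u" "ShO T a" "ShO T u"])
       (use a aO that assms ShO_closed isomorphic_refl orth_ShO in \<open>auto simp: lperp_def\<close>)
  then show "t \<in> lperp (shift T U)" using orth_shift_right[OF assms a(1)] a(1) by (simp add: lperp_def)
next
  fix t assume t: "t \<in> lperp (shift T U)"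
  then have tO: "t \<in> Obj T" unfolding lperp_def by blast
  obtain a where a: "a \<in> Obj T" "isomorphic T (ShO T a) t" using ShO_ess_surj tO by blast
  have "orth a u" if u: "u \<in> U" for u
  proof -
    have uO: "u \<in> Obj T" using u assms by blast
    have "orth t (ShO T u)" using t ShO_in_shift[OF u uO] unfolding lperp_def by blast
    then have "orth (ShO T a) (ShO T u)"
      using orth_iso[of "ShO T a" "ShO T u" t "ShO T u"] a tO uO ShO_closed isomorphic_refl by blast
    then show ?thesis using orth_ShO a uO by blast
  qed
  then have "a \<in> lperp U" using a by (simp add: lperp_def)
  then show "t \<in> shift T (lperp U)" unfolding shift_def using tO a isomorphic_sym by blast
qed

lemma orth_shift_left:
  assumes "U \<subseteq> Obj T" "x \<in> Obj T"
  shows "(\<forall>s \<in> shift T U. orth s x) \<longleftrightarrow> (\<forall>u \<in> U. orth (ShO T u) x)"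
proof
  show "\<forall>u \<in> U. orth (ShO T u) x" if "\<forall>s \<in> shift T U. orth s x"
    using that ShO_in_shift assms by blast
next
  assume *: "\<forall>u \<in> U. orth (ShO T u) x"
  show "\<forall>s \<in> shift T U. orth s x"
  proof
    fix s assume "s \<in> shift T U"
    then obtain u where u: "s \<in> Obj T" "u \<in> U" "isomorphic T s (ShO T u)"
      unfolding shift_def by blast
    show "orth s x"
      by (rule orth_iso[of s x "ShO T u" x])
         (use u * assms isomorphic_refl ShO_closed in auto)
  qed
qed

lemma shift_rperp:
  assumes "U \<subseteq> Obj T"
  shows "shift T (rperp U) = rperp (shift T U)"
proof (intro Set.set_eqI iffI)
  fix t assume "t \<in> shift T (rperp U)"
  then obtain a where a: "t \<in> Obj T" "a \<in> rperp U" "isomorphic T t (ShO T a)"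
    unfolding shift_def by blast
  have aO: "a \<in> Obj T" using a unfolding rperp_def by blast
  have "orth (ShO T u) t" if "u \<in> U" for u
    by (rule orth_iso[of "ShO T u" t "ShO T u" "ShO T a"])
       (use a aO that assms ShO_closed isomorphic_refl orth_ShO in \<open>auto simp: rperp_def\<close>)
  then show "t \<in> rperp (shift T U)" using orth_shift_left[OF assms a(1)] a(1) by (simp add: rperp_def)
next
  fix t assume t: "t \<in> rperp (shift T U)"
  then have tO: "t \<in> Obj T" unfolding rperp_def by blast
  obtain a where a: "a \<in> Obj T" "isomorphic T (ShO T a) t" using ShO_ess_surj tO by blast
  have "orth u a" if u: "u \<in> U" for u
  proof -
    have uO: "u \<in> Obj T" using u assms by blast
    have "orth (ShO T u) t" using t ShO_in_shift[OF u uO] unfolding rperp_def by blast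
    then have "orth (ShO T u) (ShO T a)"
      using orth_iso[of "ShO T u" "ShO T a" "ShO T u" t] a tO uO ShO_closed isomorphic_refl by blast
    then show ?thesis using orth_ShO a uO by blast
  qed
  then have "a \<in> rperp U" using a by (simp add: rperp_def)
  then show "t \<in> shift T (rperp U)" unfolding shift_def using tO a isomorphic_sym by blast
qed

lemma unshift_lperp_subset:
  assumes "U \<subseteq> Obj T" "shift T U \<subseteq> U"
  shows "unshift T (lperp U) \<subseteq> lperp U"
proof
  fix w assume "w \<in> unshift T (lperp U)"
  then obtain a where a: "w \<in> Obj T" "a \<in> lperp U" "isomorphic T (ShO T w) a"
    unfolding unshift_def by blast
  have S: "ShO T w \<in> lperp U" using perp_iso(1)[OF assms(1) a(3) _ a(2)] ShO_closed a by blast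
  have "orth w u" if u: "u \<in> U" for u
  proof -
    have uO: "u \<in> Obj T" using u assms by blast
    have "ShO T u \<in> U" using ShO_in_shift[OF u uO] assms by blast
    then show ?thesis using S orth_ShO[OF a(1) uO] unfolding lperp_def by blast
  qed
  then show "w \<in> lperp U" using a by (simp add: lperp_def)
qed

text \<open>This form is visibly preserved by the shift, which commutes with orthogonals. The
  closure of \<open>A\<close> under desuspension appears as closure of \<open>B\<close> under
  suspension, since Hom(\<open>w\<close>, \<open>b\<close>) = 0 is the same as
  Hom(\<open>\<Sigma>w\<close>, \<open>\<Sigma>b\<close>) = 0.\<close>

lemma co_t_structure_iff:
  "co_t_structure T A B \<longleftrightarrow> A = lperp B \<and> B = rperp A \<and> shift T B \<subseteq> B \<and> star T A B = Obj T"
proof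
  assume *: "co_t_structure T A B"
  then have AB: "A \<subseteq> Obj T" "B \<subseteq> Obj T" and un: "unshift T A \<subseteq> A" and st: "star T A B = Obj T"
    and sA: "\<And>a t. a \<in> A \<Longrightarrow> summand T t a \<Longrightarrow> t \<in> A"
    and sB: "\<And>b t. b \<in> B \<Longrightarrow> summand T t b \<Longrightarrow> t \<in> B"
    unfolding co_t_structure_def summand_closed_in_def using summand_Obj by auto
  have o: "\<And>a b. a \<in> A \<Longrightarrow> b \<in> B \<Longrightarrow> orth a b"
    using * unfolding co_t_structure_def orth_def by blast
  have 1: "A = lperp B"
  proof (intro Set.set_eqI iffI)
    fix t assume t: "t \<in> lperp B"
    then obtain a b where ab: "a \<in> A" "b \<in> B" "tri a t b"
      using st star_iff unfolding lperp_def by blast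
    then have "summand T t a" using tri_orth_summand(2) t unfolding lperp_def by blast
    then show "t \<in> A" using sA ab by blast
  qed (use o AB in \<open>auto simp: lperp_def\<close>)
  have 2: "B = rperp A"
  proof (intro Set.set_eqI iffI)
    fix t assume t: "t \<in> rperp A"
    then obtain a b where ab: "a \<in> A" "b \<in> B" "tri a t b"
      using st star_iff unfolding rperp_def by blast
    then have "summand T t b" using tri_orth_summand(1) t unfolding rperp_def by blast
    then show "t \<in> B" using sB ab by blast
  qed (use o AB in \<open>auto simp: rperp_def\<close>)
  have "shift T B \<subseteq> B"
  proof -
    have "\<forall>s \<in> shift T B. orth a s" if a: "a \<in> A" for a
    proof -
      have aO: "a \<in> Obj T" using a AB by blast
      obtain w where w: "w \<in> Obj T" "isomorphic T (ShO T w) a" using ShO_ess_surj aO by blast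
      then have wA: "w \<in> A" using un a unfolding unshift_def by blast
      have "orth a (ShO T b)" if b: "b \<in> B" for b
      proof -
        have bO: "b \<in> Obj T" using b AB by blast
        have "orth (ShO T w) (ShO T b)" using o[OF wA b] orth_ShO w bO by blast
        then show ?thesis
          using orth_iso[of a "ShO T b" "ShO T w" "ShO T b"] w aO bO ShO_closed isomorphic_refl
            isomorphic_sym by blast
      qed
      then show ?thesis using orth_shift_right AB aO by blast
    qed
    then show ?thesis using 2 shift_Obj unfolding rperp_def by blast
  qed
  with 1 2 st show "A = lperp B \<and> B = rperp A \<and> shift T B \<subseteq> B \<and> star T A B = Obj T"
    by (intro conjI)
next
  assume *: "A = lperp B \<and> B = rperp A \<and> shift T B \<subseteq> B \<and> star T A B = Obj T"
  then have A: "A = lperp B" and B: "B = rperp A" and sh: "shift T B \<subseteq> B"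
    and st: "star T A B = Obj T" by blast+
  have AO: "A \<subseteq> Obj T" by (subst A) (simp add: lperp_def)
  have BO: "B \<subseteq> Obj T" by (subst B) (simp add: rperp_def)
  have "summand_closed_in T (Obj T) A" by (subst A) (rule summand_closed_perp(1)[OF BO])
  moreover have "summand_closed_in T (Obj T) B"
    by (subst B) (rule summand_closed_perp(2)[OF AO])
  moreover have "unshift T A \<subseteq> A" unfolding A by (rule unshift_lperp_subset[OF BO sh])
  moreover have "\<And>a b. a \<in> lperp B \<Longrightarrow> b \<in> B \<Longrightarrow> Hom T a b = {Zer T a b}"
    unfolding lperp_def orth_def by blast
  then have "\<forall>a \<in> A. \<forall>b \<in> B. Hom T a b = {Zer T a b}" unfolding A[symmetric] by blast
  ultimately show "co_t_structure T A B" unfolding co_t_structure_def using AO BO st by blast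
qed

lemma star_shift:
  assumes "A \<subseteq> Obj T" "B \<subseteq> Obj T" "star T A B = Obj T"
  shows "star T (shift T A) (shift T B) = Obj T"
proof
  show "Obj T \<subseteq> star T (shift T A) (shift T B)"
  proof
    fix t assume t: "t \<in> Obj T"
    obtain s where s: "s \<in> Obj T" "isomorphic T (ShO T s) t" using ShO_ess_surj t by blast
    obtain a b where ab: "a \<in> A" "b \<in> B" "tri a s b" using assms(3) s star_iff by blast
    have "a \<in> Obj T" "b \<in> Obj T" using ab assms by auto
    moreover from this have "tri (ShO T a) t (ShO T b)"
      using tri_iso[OF tri_shift[OF ab(3)]] t s isomorphic_refl ShO_closed by blast
    ultimately show "t \<in> star T (shift T A) (shift T B)" using star_iff ab ShO_in_shift by blast
  qed
qed (simp add: star_def)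

lemma co_t_structure_shift:
  assumes "co_t_structure T A B"
  shows "co_t_structure T (shift T A) (shift T B)"
proof -
  have *: "A = lperp B" "B = rperp A" "shift T B \<subseteq> B" "star T A B = Obj T"
    using assms co_t_structure_iff by blast+
  have AB: "A \<subseteq> Obj T" "B \<subseteq> Obj T" using assms unfolding co_t_structure_def by auto
  have "shift T A = lperp (shift T B)" by (subst *(1)) (rule shift_lperp[OF AB(2)])
  moreover have "shift T B = rperp (shift T A)" by (subst *(2)) (rule shift_rperp[OF AB(1)])
  ultimately show ?thesis
    unfolding co_t_structure_iff using shift_mono[OF *(3)] star_shift[OF AB *(4)] by (intro conjI)
qed


text \<open>The adjunction between desuspension and shift, with an arbitrary \<open>w\<close> over
  \<open>x\<close> as the desuspension. It is the bridge between extensions from \<open>X\<close>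
  and maps from \<open>unshift T X\<close>.\<close>

lemma orth_unshift_left:
  assumes "w \<in> Obj T" "x \<in> Obj T" "z \<in> Obj T" "isomorphic T (ShO T w) x"
  shows "orth w z \<longleftrightarrow> orth x (ShO T z)"
proof -
  have "orth (ShO T w) (ShO T z) \<longleftrightarrow> orth x (ShO T z)"
    using orth_iso[of "ShO T w" "ShO T z" x "ShO T z"] orth_iso[of x "ShO T z" "ShO T w" "ShO T z"]
      assms isomorphic_sym[OF assms(4)] isomorphic_refl ShO_closed by blast
  then show ?thesis using orth_ShO assms by blast
qed

end

section \<open>Co-t-structures and cotorsion pairs\<close>

locale category_with_co_t_structure = triangulated_category T
  for T :: "('o, 'm, 'z) triangulated_category_scheme" (structure) +
  fixes A B :: "'o set"
  assumes co_t: "co_t_structure T A B"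
begin

abbreviation "SA \<equiv> shift T A"
abbreviation "SB \<equiv> shift T B"
abbreviation "SSA \<equiv> shift T (shift T A)"
abbreviation "SSB \<equiv> shift T (shift T B)"
abbreviation "C \<equiv> extended_coheart T A B"

lemma A_Obj: "A \<subseteq> Obj T" and B_Obj: "B \<subseteq> Obj T"
  using co_t unfolding co_t_structure_def by auto

lemma A_eq: "A = lperp B" and B_eq: "B = rperp A"
  using co_t co_t_structure_iff by blast+

lemma SB_subset: "SB \<subseteq> B" and SSB_subset: "SSB \<subseteq> SB"
  using co_t co_t_structure_shift[OF co_t] co_t_structure_iff by blast+

lemma SA_eq: "SA = lperp SB" and SB_eq: "SB = rperp SA"
  using co_t_structure_shift[OF co_t] co_t_structure_iff by blast+

lemma SSA_eq: "SSA = lperp SSB"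
  using co_t_structure_shift[OF co_t_structure_shift[OF co_t]] co_t_structure_iff by blast+

lemma SA_subset: "SA \<subseteq> SSA"
  using SSB_subset SA_eq SSA_eq unfolding lperp_def by blast

lemma orth_A_B: "a \<in> A \<Longrightarrow> b \<in> B \<Longrightarrow> orth a b"
  using A_eq unfolding lperp_def by blast

lemma orth_SA_SB: "a \<in> SA \<Longrightarrow> b \<in> SB \<Longrightarrow> orth a b"
  using SA_eq unfolding lperp_def by blast

lemma orth_SSA_SSB: "a \<in> SSA \<Longrightarrow> b \<in> SSB \<Longrightarrow> orth a b"
  using SSA_eq unfolding lperp_def by blast

lemma ShO_A: "a \<in> A \<Longrightarrow> ShO T a \<in> SA" and ShO_B: "b \<in> B \<Longrightarrow> ShO T b \<in> SB"
  and ShO_SB: "b \<in> SB \<Longrightarrow> ShO T b \<in> SSB"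
  using ShO_in_shift A_Obj B_Obj shift_Obj by blast+

lemma in_AI: "t \<in> Obj T \<Longrightarrow> (\<And>b. b \<in> B \<Longrightarrow> orth t b) \<Longrightarrow> t \<in> A"
  using A_eq unfolding lperp_def by blast

lemma in_BI: "t \<in> Obj T \<Longrightarrow> (\<And>a. a \<in> A \<Longrightarrow> orth a t) \<Longrightarrow> t \<in> B"
  using B_eq unfolding rperp_def by blast

lemma in_SSAI: "t \<in> Obj T \<Longrightarrow> (\<And>s. s \<in> SB \<Longrightarrow> orth t (ShO T s)) \<Longrightarrow> t \<in> SSA"
  using SSA_eq orth_shift_right[OF shift_Obj, of t B] unfolding lperp_def by blast

lemma unshift_A: "unshift T A \<subseteq> A"
  using co_t unfolding co_t_structure_def by blast

lemma triangle_A_B: "t \<in> Obj T \<Longrightarrow> \<exists>a \<in> A. \<exists>b \<in> B. tri a t b"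
  using co_t star_iff unfolding co_t_structure_def by blast

lemma triangle_SSA_SSB: "t \<in> Obj T \<Longrightarrow> \<exists>a \<in> SSA. \<exists>b \<in> SSB. tri a t b"
  using co_t_structure_shift[OF co_t_structure_shift[OF co_t]] star_iff co_t_structure_iff by blast

lemma C_iff: "c \<in> C \<longleftrightarrow> c \<in> SSA \<and> c \<in> B"
  unfolding extended_coheart_def by blast

lemma E_triangle_iff: "E_triangle T C a b c \<longleftrightarrow> a \<in> C \<and> b \<in> C \<and> c \<in> C \<and> tri a b c"
  unfolding E_triangle_def tri_def by blast

text \<open>Only membership in \<open>B\<close> is at stake. For \<open>a\<close> in
  \<open>A\<close>, Hom(\<open>a\<close>, \<open>s\<close>) is squeezed between
  Hom(\<open>a\<close>, \<open>b\<close>) and Hom(\<open>\<Sigma>a\<close>, \<open>r\<close>); the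
  latter vanishes because \<open>\<Sigma>A \<subseteq> \<Sigma>\<^sup>2A\<close>.\<close>

lemma truncation_in_C:
  assumes "b \<in> B" "s \<in> SSA" "r \<in> SSB" "tri s b r"
  shows "s \<in> C"
proof -
  have sO: "s \<in> Obj T" using assms shift_Obj by blast
  have "orth a s" if a: "a \<in> A" for a
  proof -
    have "orth (ShO T a) r" using orth_SSA_SSB[OF _ assms(3)] ShO_A a SA_subset by blast
    then show ?thesis using orth_extension_ShO(2)[OF assms(4)] orth_A_B a assms(1) A_Obj by blast
  qed
  then show ?thesis using in_BI sO assms(2) C_iff by blast
qed

end

section \<open>From cotorsion pairs to co-t-structures\<close>

locale cotorsion_pair_in_coheart = category_with_co_t_structure T A B
  for T :: "('o, 'm, 'z) triangulated_category_scheme" (structure) and A B +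
  fixes X Y :: "'o set"
  assumes cotorsion: "complete_cotorsion_pair T (extended_coheart T A B) X Y"
begin

lemma X_C: "X \<subseteq> C" and Y_C: "Y \<subseteq> C"
  and summand_X: "\<And>x t. x \<in> X \<Longrightarrow> t \<in> C \<Longrightarrow> summand T t x \<Longrightarrow> t \<in> X"
  and summand_Y: "\<And>x t. x \<in> Y \<Longrightarrow> t \<in> C \<Longrightarrow> summand T t x \<Longrightarrow> t \<in> Y"
  using cotorsion unfolding complete_cotorsion_pair_def summand_closed_in_def by blast+

lemma orth_X_Y: "x \<in> X \<Longrightarrow> y \<in> Y \<Longrightarrow> orth x (ShO T y)"
  using cotorsion unfolding complete_cotorsion_pair_def Ext_def orth_def by blast

lemma preenvelope: "c \<in> C \<Longrightarrow> \<exists>x \<in> X. \<exists>y \<in> Y. tri c y x"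
  and precover: "c \<in> C \<Longrightarrow> \<exists>x \<in> X. \<exists>y \<in> Y. tri y x c"
  using cotorsion E_triangle_iff unfolding complete_cotorsion_pair_def by blast+

lemma X_Obj: "X \<subseteq> Obj T" and Y_Obj: "Y \<subseteq> Obj T"
  using X_C Y_C C_iff B_Obj by blast+

lemma X_SSA: "X \<subseteq> SSA" and Y_B: "Y \<subseteq> B"
  using X_C Y_C C_iff by blast+

text \<open>In the triangle \<open>y \<rightarrow> x \<rightarrow> c\<close> the connecting map
  \<open>c \<rightarrow> \<Sigma>y\<close> vanishes, so \<open>c\<close> splits off
  \<open>x\<close>.\<close>

lemma in_XI:
  assumes c: "c \<in> C" and "\<And>y. y \<in> Y \<Longrightarrow> orth c (ShO T y)"
  shows "c \<in> X"
proof -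
  obtain x y where xy: "x \<in> X" "y \<in> Y" "tri y x c" using precover c by blast
  have "summand T c x" using tri_orth_summand(2)[OF tri_rotate[OF xy(3)]] assms(2) xy(2) by blast
  then show ?thesis using summand_X xy c by blast
qed

text \<open>Dually, in \<open>c \<rightarrow> y \<rightarrow> x\<close> the connecting map vanishes;
  it is treated in desuspended form, as a map \<open>w \<rightarrow> c\<close>.\<close>

lemma in_YI:
  assumes c: "c \<in> C" and "\<And>x. x \<in> X \<Longrightarrow> orth x (ShO T c)"
  shows "c \<in> Y"
proof -
  obtain x y where xy: "x \<in> X" "y \<in> Y" "tri c y x" using preenvelope c by blast
  obtain w where w: "w \<in> Obj T" "isomorphic T (ShO T w) x" "tri w c y"
    using tri_unrotate xy(3) by blast
  have "x \<in> Obj T" "c \<in> Obj T" using tri_Obj xy(3) by blast+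
  then have "orth w c" using orth_unshift_left[OF w(1) _ _ w(2)] assms(2) xy(1) by blast
  then have "summand T c y" using tri_orth_summand(1)[OF w(3)] by blast
  then show ?thesis using summand_Y xy c by blast
qed

lemma orth_unshift_X:
  assumes "z \<in> Obj T"
  shows "(\<forall>w \<in> unshift T X. orth w z) \<longleftrightarrow> (\<forall>x \<in> X. orth x (ShO T z))"
proof
  show "\<forall>w \<in> unshift T X. orth w z" if "\<forall>x \<in> X. orth x (ShO T z)"
    using that orth_unshift_left assms X_Obj unfolding unshift_def by blast
  show "\<forall>x \<in> X. orth x (ShO T z)" if *: "\<forall>w \<in> unshift T X. orth w z"
  proof
    fix x assume x: "x \<in> X"
    then have xO: "x \<in> Obj T" using X_Obj by blast
    obtain w where w: "w \<in> Obj T" "isomorphic T (ShO T w) x" using ShO_ess_surj xO by blast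
    then have "w \<in> unshift T X" using x unfolding unshift_def by blast
    then show "orth x (ShO T z)" using * orth_unshift_left[OF w(1) xO assms w(2)] by blast
  qed
qed

lemma star_A_X: "star T (unshift T A) (unshift T X) = lperp (Y \<union> SB)"
proof (intro subset_antisym subsetI)
  have U: "Y \<union> SB \<subseteq> Obj T" using Y_Obj shift_Obj by blast
  fix t assume "t \<in> star T (unshift T A) (unshift T X)"
  then obtain w v where w: "w \<in> unshift T A" and v: "v \<in> unshift T X" and tr: "tri w t v"
    using star_iff by blast
  have wA: "w \<in> A" using w unshift_A by blast
  then have "w \<in> lperp (Y \<union> SB)" using orth_A_B Y_B SB_subset A_Obj unfolding lperp_def by blast
  moreover have vO: "v \<in> Obj T" using v unshift_Obj by blast
  have "orth v u" if u: "u \<in> Y \<union> SB" for u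
  proof -
    have uO: "u \<in> Obj T" using u U by blast
    have "orth x (ShO T u)" if x: "x \<in> X" for x
    proof -
      have "x \<in> SSA" using x X_SSA by blast
      then show ?thesis using u orth_X_Y x orth_SSA_SSB ShO_SB by blast
    qed
    then show ?thesis using orth_unshift_X[OF uO] v by blast
  qed
  then have "v \<in> lperp (Y \<union> SB)" using vO by (simp add: lperp_def)
  ultimately show "t \<in> lperp (Y \<union> SB)" using perp_extension(1)[OF U tr] by blast
next
  fix t assume t: "t \<in> lperp (Y \<union> SB)"
  then have tO: "t \<in> Obj T" and tY: "\<And>y. y \<in> Y \<Longrightarrow> orth t y" and tS: "\<And>s. s \<in> SB \<Longrightarrow> orth t s"
    unfolding lperp_def by blast+
  \<comment> \<open>The shift of \<open>t\<close> is truncated, not \<open>t\<close>, because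
    desuspending the outcome must give terms of \<open>unshift T A\<close> and
    \<open>unshift T X\<close>.\<close>
  obtain a b where a: "a \<in> A" and b: "b \<in> B" and tr: "tri a (ShO T t) b"
    using triangle_A_B ShO_closed tO by blast
  have aO: "a \<in> Obj T" and bO: "b \<in> Obj T" using a b A_Obj B_Obj by blast+
  \<comment> \<open>Hom(\<open>b\<close>, \<open>\<Sigma>u\<close>) is squeezed between
    Hom(\<open>\<Sigma>t\<close>, \<open>\<Sigma>u\<close>) and \<open>\<Sigma>\<close>-shifted maps
    from \<open>a\<close>. With \<open>u\<close> in \<open>SB\<close> this puts \<open>b\<close> in
    the coheart, with \<open>u\<close> in \<open>Y\<close> it puts \<open>b\<close> in
    \<open>X\<close>.\<close>
  have orth_b: "orth b (ShO T u)" if u: "u \<in> Obj T" and tu: "orth t u" and au: "orth a u" for u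
    using orth_extension_ShO(1)[OF tr ShO_closed[OF u]] orth_ShO[OF tO u] orth_ShO[OF aO u] tu au
    by blast
  have "b \<in> SSA"
  proof (rule in_SSAI[OF bO])
    fix s assume s: "s \<in> SB"
    show "orth b (ShO T s)" using orth_b[OF _ tS[OF s]] orth_A_B a s SB_subset B_Obj by blast
  qed
  then have bX: "b \<in> X"
    using in_XI orth_b tY orth_A_B a b Y_B Y_Obj C_iff by blast
  obtain a' b' where "a' \<in> Obj T" "b' \<in> Obj T" "isomorphic T (ShO T a') a"
    "isomorphic T (ShO T b') b" "tri a' t b'"
    using tri_unshift[OF tr tO] by blast
  then show "t \<in> star T (unshift T A) (unshift T X)"
    using a bX star_iff unfolding unshift_def by blast
qed

lemma star_Y_B: "star T Y SSB = rperp (A \<union> unshift T X)"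
proof (intro subset_antisym subsetI)
  have U: "A \<union> unshift T X \<subseteq> Obj T" using A_Obj unshift_Obj by blast
  fix t assume "t \<in> star T Y SSB"
  then obtain y r where y: "y \<in> Y" and r: "r \<in> SSB" and tr: "tri y t r"
    using star_iff by blast
  have yO: "y \<in> Obj T" and rO: "r \<in> Obj T" using tri_Obj[OF tr] by blast+
  have "r \<in> B" using r SSB_subset SB_subset by blast
  have "\<forall>w \<in> unshift T X. orth w y" using orth_unshift_X[OF yO] orth_X_Y y by blast
  then have "y \<in> rperp (A \<union> unshift T X)" using yO orth_A_B y Y_B unfolding rperp_def by blast
  moreover have "ShO T r \<in> SSB" using r SSB_subset ShO_SB by blast
  then have "\<forall>w \<in> unshift T X. orth w r"
    using orth_unshift_X[OF rO] orth_SSA_SSB X_SSA by blast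
  then have "r \<in> rperp (A \<union> unshift T X)"
    using rO orth_A_B \<open>r \<in> B\<close> unfolding rperp_def by blast
  ultimately show "t \<in> rperp (A \<union> unshift T X)" using perp_extension(2)[OF U tr] by blast
next
  fix t assume t: "t \<in> rperp (A \<union> unshift T X)"
  then have tO: "t \<in> Obj T" and At: "\<And>a. a \<in> A \<Longrightarrow> orth a t"
    and Xt: "\<And>x. x \<in> X \<Longrightarrow> orth x (ShO T t)"
    using orth_unshift_X unfolding rperp_def by blast+
  obtain s r where s: "s \<in> SSA" and r: "r \<in> SSB" and tr: "tri s t r"
    using triangle_SSA_SSB tO by blast
  have tB: "t \<in> B" using in_BI tO At by blast
  then have sC: "s \<in> C" using truncation_in_C s r tr by blast
  have "s \<in> Y"
  proof (rule in_YI[OF sC])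
    fix x assume x: "x \<in> X"
    then have xO: "x \<in> Obj T" using X_Obj by blast
    have "ShO T r \<in> SSB" using r SSB_subset ShO_SB by blast
    then have "orth x r" using orth_SSA_SSB X_SSA x r by blast
    then have "orth (ShO T x) (ShO T r)" using orth_ShO xO r shift_Obj by blast
    \<comment> \<open>Hom(\<open>x\<close>, \<open>\<Sigma>s\<close>) is squeezed between
      Hom(\<open>x\<close>, \<open>\<Sigma>t\<close>) and Hom(\<open>\<Sigma>x\<close>,
      \<open>\<Sigma>r\<close>).\<close>
    then show "orth x (ShO T s)"
      using orth_extension_ShO(2)[OF tri_shift[OF tr] xO] Xt[OF x] by blast
  qed
  then show "t \<in> star T Y SSB" using star_iff r tr by blast
qed

text \<open>With \<open>SB\<close> in this orthogonal and \<open>A\<close> in the next,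
  \<open>A' \<subseteq> SA\<close> and \<open>B' \<subseteq> B\<close> follow by monotonicity
  alone.\<close>

abbreviation "A' \<equiv> lperp (Y \<union> SB)"
abbreviation "B' \<equiv> rperp (A \<union> unshift T X)"

lemma add_closure_star_A_X: "add_closure T (star T (unshift T A) (unshift T X)) = A'"
  unfolding star_A_X using Y_Obj shift_Obj by (intro add_closure_lperp) blast

lemma add_closure_star_Y_B: "add_closure T (star T Y SSB) = B'"
  unfolding star_Y_B using A_Obj unshift_Obj by (intro add_closure_rperp) blast

lemma A_subset_A': "A \<subseteq> A'"
  using orth_A_B Y_B SB_subset A_Obj unfolding lperp_def by blast

lemma A'_subset_SA: "A' \<subseteq> SA"
  using SA_eq unfolding lperp_def by blast

lemma B'_subset_B: "B' \<subseteq> B"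
  using B_eq unfolding rperp_def by blast

text \<open>By \<open>star_Y_B\<close> an object of \<open>B'\<close> is an extension of a term of
  \<open>SSB\<close> by one of \<open>Y\<close>, and \<open>A'\<close> is orthogonal to both because
  \<open>SSB \<subseteq> SB\<close>.\<close>

lemma orth_A'_B': "a \<in> A' \<Longrightarrow> b \<in> B' \<Longrightarrow> orth a b"
proof -
  assume a: "a \<in> A'" and b: "b \<in> B'"
  obtain y r where y: "y \<in> Y" "r \<in> SSB" "tri y b r" using b star_iff unfolding star_Y_B[symmetric] by blast
  then have "orth a y" "orth a r" "a \<in> Obj T" using a SSB_subset unfolding lperp_def by blast+
  then show ?thesis using orth_extension(2) y by blast
qed

text \<open>The decomposition of \<open>t\<close> regroups \<open>A * C * \<Sigma>\<^sup>2B\<close> along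
  \<open>C \<subseteq> \<Sigma>\<^sup>-\<^sup>1X * Y\<close>.\<close>

lemma star_A'_B': "star T A' B' = Obj T"
proof (intro subset_antisym subsetI)
  fix t assume "t \<in> Obj T"
  then obtain a b where a: "a \<in> A" and b: "b \<in> B" and t: "tri a t b" using triangle_A_B by blast
  obtain c r where c: "c \<in> SSA" and r: "r \<in> SSB" and cbr: "tri c b r"
    using triangle_SSA_SSB b B_Obj by blast
  have "c \<in> C" using truncation_in_C b c r cbr by blast
  then obtain x y where x: "x \<in> X" and y: "y \<in> Y" and cyx: "tri c y x" using preenvelope by blast
  \<comment> \<open>Pushing \<open>b\<close> out along \<open>c \<rightarrow> y\<close> replaces the
    coheart part of \<open>b\<close> by \<open>y\<close>, which puts \<open>v\<close> in
    \<open>B'\<close>; the price is the cone \<open>x\<close> of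
    \<open>b \<rightarrow> v\<close>.\<close>
  obtain v where v: "tri b v x" "tri y v r" using octahedron_pushout[OF cyx cbr] by blast
  \<comment> \<open>The fibre of \<open>t \<rightarrow> v\<close> collects the \<open>A\<close>-part
    of \<open>t\<close> and the desuspended \<open>x\<close>. Its shift \<open>k\<close> is tested
    against the shifts of \<open>Y\<close> and \<open>SB\<close>.\<close>
  obtain k where k: "tri t v k" "tri (ShO T a) k x" using octahedron_fibres[OF t v(1)] by blast
  obtain k' where k': "k' \<in> Obj T" "isomorphic T (ShO T k') k" "tri k' t v"
    using tri_unrotate[OF k(1)] by blast
  have "v \<in> B'" using star_iff v(2) y r unfolding star_Y_B[symmetric] by blast
  moreover have "orth k' u" if u: "u \<in> Y \<union> SB" for u
  proof -
    have uO: "u \<in> Obj T" using u Y_Obj shift_Obj by blast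
    have "orth a u" using orth_A_B a u Y_B SB_subset by blast
    then have "orth (ShO T a) (ShO T u)" using orth_ShO a uO A_Obj by blast
    moreover have "x \<in> SSA" using x X_SSA by blast
    then have "orth x (ShO T u)" using u orth_X_Y x orth_SSA_SSB ShO_SB by blast
    ultimately have "orth k (ShO T u)" using orth_extension(1)[OF k(2) ShO_closed[OF uO]] by blast
    then show ?thesis using orth_unshift_left[OF k'(1) _ uO k'(2)] tri_Obj[OF k(2)] by blast
  qed
  then have "k' \<in> A'" using k'(1) by (simp add: lperp_def)
  ultimately show "t \<in> star T A' B'" using k'(3) star_iff by blast
qed (simp add: star_def)

text \<open>The bounds suffice: desuspending \<open>A' \<subseteq> SA\<close> lands in
  \<open>A\<close>, which lies in \<open>A'\<close>.\<close>

lemma unshift_A': "unshift T A' \<subseteq> A'"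
proof
  fix w assume "w \<in> unshift T A'"
  then obtain a where w: "w \<in> Obj T" and a: "a \<in> A'" and wa: "isomorphic T (ShO T w) a"
    unfolding unshift_def by blast
  have aO: "a \<in> Obj T" and aS: "a \<in> SA" using a A'_subset_SA unfolding lperp_def by blast+
  have "w \<in> A"
    using in_AI[OF w] orth_unshift_left[OF w aO _ wa] orth_SA_SB[OF aS] ShO_B B_Obj by blast
  then show "w \<in> A'" using A_subset_A' by blast
qed

lemma co_t_structure_A'_B': "co_t_structure T A' B'"
proof -
  have "A' \<subseteq> Obj T" "B' \<subseteq> Obj T" unfolding lperp_def rperp_def by blast+
  moreover have "summand_closed_in T (Obj T) A'" "summand_closed_in T (Obj T) B'"
    using Y_Obj shift_Obj A_Obj unshift_Obj by (intro summand_closed_perp; blast)+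
  moreover have "\<forall>a \<in> A'. \<forall>b \<in> B'. Hom T a b = {Zer T a b}"
    using orth_A'_B' unfolding orth_def by blast
  ultimately show ?thesis unfolding co_t_structure_def
    using unshift_A' star_A'_B' by (intro conjI)
qed

text \<open>For a shift \<open>c\<close> of an object of \<open>A'\<close>, orthogonality to
  \<open>SB\<close> becomes vanishing on \<open>SSB\<close>, which places \<open>c\<close> in the
  coheart if it is in \<open>B\<close>; orthogonality to \<open>Y\<close> becomes the vanishing of
  extensions that characterises \<open>X\<close>.\<close>

lemma B_Int_shift_A': "B \<inter> shift T A' = X"
proof (intro subset_antisym subsetI)
  fix c assume "c \<in> B \<inter> shift T A'"
  then obtain a where c: "c \<in> B" and a: "a \<in> A'" and ca: "isomorphic T c (ShO T a)"
    unfolding shift_def by blast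
  have aO: "a \<in> Obj T" and cO: "c \<in> Obj T" using a c B_Obj unfolding lperp_def by blast+
  have *: "orth c (ShO T u)" if "u \<in> Y \<union> SB" for u
    using orth_unshift_left[OF aO cO _ isomorphic_sym[OF ca], of u] a that Y_Obj shift_Obj
    unfolding lperp_def by blast
  then have "c \<in> C" using in_SSAI[OF cO] C_iff c by blast
  then show "c \<in> X" using in_XI * by blast
next
  fix x assume x: "x \<in> X"
  then have xO: "x \<in> Obj T" and xS: "x \<in> SSA" and xB: "x \<in> B" using X_C C_iff B_Obj by blast+
  obtain w where w: "w \<in> Obj T" "isomorphic T (ShO T w) x" using ShO_ess_surj xO by blast
  have "orth w u" if u: "u \<in> Y \<union> SB" for u
    using orth_unshift_left[OF w(1) xO _ w(2), of u] u Y_Obj shift_Obj orth_X_Y[OF x]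
      orth_SSA_SSB[OF xS] ShO_SB by blast
  then have "w \<in> A'" using w by (simp add: lperp_def)
  then show "x \<in> B \<inter> shift T A'" using xB xO w isomorphic_sym unfolding shift_def by blast
qed

lemma B'_Int_SSA: "B' \<inter> SSA = Y"
proof (intro subset_antisym subsetI)
  fix c assume c: "c \<in> B' \<inter> SSA"
  then have "c \<in> C" using B'_subset_B C_iff by blast
  moreover have "orth x (ShO T c)" if "x \<in> X" for x
    using c orth_unshift_X[of c] that unfolding rperp_def by blast
  ultimately show "c \<in> Y" using in_YI by blast
next
  fix y assume y: "y \<in> Y"
  then have yO: "y \<in> Obj T" and yS: "y \<in> SSA" and yB: "y \<in> B" using Y_C C_iff B_Obj by blast+
  have "\<forall>w \<in> unshift T X. orth w y" using orth_unshift_X[OF yO] orth_X_Y y by blast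
  then show "y \<in> B' \<inter> SSA" using yS yO orth_A_B yB unfolding rperp_def by blast
qed

end

section \<open>From intermediate co-t-structures to cotorsion pairs\<close>

locale intermediate_co_t_structure = category_with_co_t_structure T A B
  for T :: "('o, 'm, 'z) triangulated_category_scheme" (structure) and A B +
  fixes A' B' :: "'o set"
  assumes co_t': "co_t_structure T A' B'" and lower: "A \<subseteq> A'" and upper: "A' \<subseteq> shift T A"
begin

sublocale intermediate: category_with_co_t_structure T A' B'
  by unfold_locales (rule co_t')

lemma B'_subset: "B' \<subseteq> B"
  using intermediate.B_eq B_eq lower unfolding rperp_def by blast

lemma SB_subset_B': "SB \<subseteq> B'"
  using intermediate.B_eq SB_eq upper unfolding rperp_def by blast

lemma SA'_subset: "shift T A' \<subseteq> SSA"
  by (rule shift_mono[OF upper])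

abbreviation "X \<equiv> B \<inter> shift T A'"
abbreviation "Y \<equiv> B' \<inter> SSA"

lemma XY_C: "X \<subseteq> C" "Y \<subseteq> C"
  using SA'_subset B'_subset C_iff by blast+

text \<open>As intersections of orthogonals, \<open>X\<close> and \<open>Y\<close> are additive and
  summand-closed for formal reasons.\<close>

lemma X_eq: "X = lperp (shift T B') \<inter> rperp A" and Y_eq: "Y = lperp SSB \<inter> rperp A'"
  using intermediate.SA_eq B_eq SSA_eq intermediate.B_eq by blast+

text \<open>The \<open>(A', B')\<close>-truncation \<open>a \<rightarrow> c \<rightarrow> b\<close>,
  rotated once to \<open>c \<rightarrow> b \<rightarrow> \<Sigma>a\<close>, is the required triangle
  once its new terms are seen to lie in the coheart: \<open>\<Sigma>a\<close> is an extension of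
  \<open>\<Sigma>c\<close> by \<open>b\<close>, and \<open>b\<close> one of \<open>\<Sigma>a\<close>
  by \<open>c\<close>.\<close>

lemma ex_preenvelope:
  assumes c: "c \<in> C"
  shows "\<exists>x \<in> X. \<exists>y \<in> Y. E_triangle T C c y x"
proof -
  have cO: "c \<in> Obj T" and cS: "c \<in> SSA" and cB: "c \<in> B" using c C_iff B_Obj by blast+
  obtain a b where a: "a \<in> A'" and b: "b \<in> B'" and tr: "tri a c b"
    using intermediate.triangle_A_B cO by blast
  have bO: "b \<in> Obj T" using tri_Obj[OF tr] by blast
  note tr' = tri_rotate[OF tr]
  have aS: "ShO T a \<in> shift T A'" using intermediate.ShO_A a by blast
  have "ShO T a \<in> B"
  proof (rule in_BI)
    show "ShO T a \<in> Obj T" using aS shift_Obj by blast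
    fix z assume z: "z \<in> A"
    have "orth z b" using orth_A_B z b B'_subset by blast
    moreover have "orth z (ShO T c)" using orth_A_B z cB ShO_B SB_subset by blast
    ultimately show "orth z (ShO T a)" using orth_extension(2)[OF tri_rotate[OF tr']] z A_Obj by blast
  qed
  moreover have "b \<in> SSA"
    using perp_extension(1)[OF shift_Obj tr', of "SB"] cS aS SA'_subset SSA_eq by blast
  ultimately have "ShO T a \<in> X" "b \<in> Y" using aS b by blast+
  then show ?thesis using E_triangle_iff c tr' XY_C by blast
qed

text \<open>Here a desuspension \<open>s\<close> of \<open>c\<close> is truncated, and two rotations
  of \<open>a \<rightarrow> s \<rightarrow> b\<close> give
  \<open>b \<rightarrow> \<Sigma>a \<rightarrow> c\<close>.\<close>

lemma ex_precover:
  assumes c: "c \<in> C"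
  shows "\<exists>x \<in> X. \<exists>y \<in> Y. E_triangle T C y x c"
proof -
  have cO: "c \<in> Obj T" and cS: "c \<in> SSA" and cB: "c \<in> B" using c C_iff B_Obj by blast+
  obtain s where s: "s \<in> Obj T" "isomorphic T (ShO T s) c" using ShO_ess_surj cO by blast
  obtain a b where a: "a \<in> A'" and b: "b \<in> B'" and tr: "tri a s b"
    using intermediate.triangle_A_B s by blast
  have aO: "a \<in> Obj T" and bO: "b \<in> Obj T" using tri_Obj[OF tr] by blast+
  have tr': "tri b (ShO T a) c"
    using tri_iso[OF tri_rotate[OF tri_rotate[OF tr]]] s cO aO bO isomorphic_refl ShO_closed by blast
  have aS: "ShO T a \<in> shift T A'" using intermediate.ShO_A a by blast
  have "ShO T a \<in> B"
    using perp_extension(2)[OF A_Obj tr'] b B'_subset cB B_eq by blast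
  moreover have "b \<in> SSA"
  proof (rule in_SSAI[OF bO])
    fix z assume z: "z \<in> SB"
    have zO: "z \<in> Obj T" using z shift_Obj by blast
    have zS: "ShO T z \<in> SSB" using ShO_SB z by blast
    \<comment> \<open>A second shift is needed because maps from \<open>s\<close> to
      \<open>\<Sigma>z\<close> correspond to maps from \<open>c\<close> to
      \<open>\<Sigma>\<^sup>2z\<close>.\<close>
    have c2: "ShO T (ShO T z) \<in> SSB" using ShO_SB zS SSB_subset by blast
    have az: "orth (ShO T a) (ShO T z)"
      using orth_SSA_SSB aS SA'_subset zS by blast
    have "orth c (ShO T (ShO T z))" using orth_SSA_SSB[OF cS c2] .
    then have "orth s (ShO T z)" using orth_unshift_left[OF s(1) cO _ s(2)] ShO_closed zO by blast
    then show "orth b (ShO T z)" using orth_extension_ShO(1)[OF tr ShO_closed[OF zO]] az by blast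
  qed
  ultimately have "ShO T a \<in> X" "b \<in> Y" using aS b by blast+
  then show ?thesis using E_triangle_iff c tr' XY_C by blast
qed

lemma cotorsion_pair: "complete_cotorsion_pair T C X Y"
proof -
  have *: "shift T B' \<subseteq> Obj T" "SSB \<subseteq> Obj T" using shift_Obj by blast+
  have "additive_subcategory T X" "additive_subcategory T Y"
    unfolding X_eq Y_eq
    using additive_subcategory_perp[OF *(1) A_Obj]
      additive_subcategory_perp[OF *(2) intermediate.A_Obj] by blast+
  moreover have "summand_closed_in T C X" "summand_closed_in T C Y"
    unfolding X_eq Y_eq summand_closed_in_def
    using perp_retract(1)[OF *(1)] perp_retract(2)[OF A_Obj] perp_retract(1)[OF *(2)]
      perp_retract(2)[OF intermediate.A_Obj] summand_imp_retract summand_Obj by blast+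
  moreover have "Ext T x y = {Zer T x (ShO T y)}" if "x \<in> X" "y \<in> Y" for x y
    using intermediate.orth_SA_SB intermediate.ShO_B that unfolding Ext_def orth_def by blast
  ultimately show ?thesis unfolding complete_cotorsion_pair_def
    using XY_C ex_preenvelope ex_precover by blast
qed

text \<open>Makes the converse construction available for this pair, so that returning to
  \<open>(A', B')\<close> is a comparison of orthogonals.\<close>

sublocale coheart: cotorsion_pair_in_coheart T A B X Y
  by unfold_locales (rule cotorsion_pair)

text \<open>\<open>Y\<close> and \<open>SB\<close> lie in \<open>B'\<close>, which gives one
  inclusion. For the other, \<open>star_A_X\<close> presents an object as an extension of terms from
  \<open>unshift T A\<close> and \<open>unshift T X\<close>, both inside \<open>A'\<close>, the
  second because \<open>X \<subseteq> shift T A'\<close>.\<close>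

lemma lperp_Y_SB: "lperp (Y \<union> SB) = A'"
proof (intro subset_antisym subsetI)
  show "t \<in> lperp (Y \<union> SB)" if "t \<in> A'" for t
    using that intermediate.orth_A_B SB_subset_B' intermediate.A_Obj unfolding lperp_def by blast
next
  fix t assume t: "t \<in> lperp (Y \<union> SB)"
  then obtain w v where w: "w \<in> unshift T A" and v: "v \<in> unshift T X" and tr: "tri w t v"
    using star_iff unfolding coheart.star_A_X[symmetric] by blast
  have "w \<in> A'" using w unshift_A lower by blast
  moreover have "v \<in> A'"
  proof (rule intermediate.in_AI)
    show vO: "v \<in> Obj T" using v unshift_Obj by blast
    obtain x where x: "x \<in> X" "isomorphic T (ShO T v) x" using v unfolding unshift_def by blast
    fix b assume b: "b \<in> B'"
    have "orth x (ShO T b)" using intermediate.orth_SA_SB intermediate.ShO_B x b by blast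
    then show "orth v b" using orth_unshift_left[OF vO _ _ x(2)] x b B_Obj intermediate.B_Obj by blast
  qed
  ultimately show "t \<in> A'"
    using perp_extension(1)[OF intermediate.B_Obj tr] intermediate.A_eq by blast
qed

lemma rperp_A_X: "rperp (A \<union> unshift T X) = B'"
proof (intro subset_antisym subsetI)
  fix t assume t: "t \<in> B'"
  then have tO: "t \<in> Obj T" using intermediate.B_Obj by blast
  have "\<forall>w \<in> unshift T X. orth w t"
    using coheart.orth_unshift_X[OF tO] intermediate.orth_SA_SB intermediate.ShO_B t by blast
  then show "t \<in> rperp (A \<union> unshift T X)"
    using intermediate.orth_A_B lower t tO unfolding rperp_def by blast
next
  fix t assume "t \<in> rperp (A \<union> unshift T X)"
  then obtain y r where "y \<in> Y" "r \<in> SSB" "tri y t r"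
    using star_iff unfolding coheart.star_Y_B[symmetric] by blast
  then show "t \<in> B'"
    using perp_extension(2)[OF intermediate.A_Obj] intermediate.B_eq SSB_subset SB_subset_B' by blast
qed

end

section \<open>The bijection\<close>

lemma bij_betw_mutually_inverse:
  assumes "\<And>p. p \<in> S \<Longrightarrow> f p \<in> R \<and> g (f p) = p" "\<And>q. q \<in> R \<Longrightarrow> g q \<in> S \<and> f (g q) = q"
  shows "bij_betw f S R \<and> bij_betw g R S \<and> (\<forall>p \<in> S. g (f p) = p) \<and> (\<forall>q \<in> R. f (g q) = q)"
proof -
  have "bij_betw f S R" by (rule bij_betw_byWitness[where f' = g]) (use assms in auto)
  moreover have "bij_betw g R S" by (rule bij_betw_byWitness[where f' = f]) (use assms in auto)
  ultimately show ?thesis using assms by blast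
qed

theorem theorem2p1:
  fixes T :: "('o, 'm, 'z) triangulated_category_scheme" and A B :: "'o set"
  assumes "triangulated_category T"
    and "co_t_structure T A B"
  shows "let C = extended_coheart T A B;
             CT = {(A', B'). co_t_structure T A' B' \<and> A \<subseteq> A' \<and> A' \<subseteq> shift T A};
             CP = {(X, Y). complete_cotorsion_pair T C X Y};
             \<Phi> = (\<lambda>(A', B'). (B \<inter> shift T A', B' \<inter> shift T (shift T A)));
             \<Psi> = (\<lambda>(X, Y). (add_closure T (star T (unshift T A) (unshift T X)),
                            add_closure T (star T Y (shift T (shift T B)))))
         in bij_betw \<Phi> CT CP \<and> bij_betw \<Psi> CP CT \<and>
            (\<forall>p \<in> CT. \<Psi> (\<Phi> p) = p) \<and> (\<forall>q \<in> CP. \<Phi> (\<Psi> q) = q)"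
proof -
  interpret category_with_co_t_structure T A B
    using assms by (intro category_with_co_t_structure.intro category_with_co_t_structure_axioms.intro)
  let ?CT = "{(A', B'). co_t_structure T A' B' \<and> A \<subseteq> A' \<and> A' \<subseteq> shift T A}"
  let ?CP = "{(X, Y). complete_cotorsion_pair T (extended_coheart T A B) X Y}"
  let ?\<Phi> = "\<lambda>(A', B'). (B \<inter> shift T A', B' \<inter> shift T (shift T A))"
  let ?\<Psi> = "\<lambda>(X, Y). (add_closure T (star T (unshift T A) (unshift T X)),
                            add_closure T (star T Y (shift T (shift T B))))"
  have 1: "?\<Phi> p \<in> ?CP \<and> ?\<Psi> (?\<Phi> p) = p" if p: "p \<in> ?CT" for p
  proof -
    obtain A' B' where p': "p = (A', B')" by (cases p)
    interpret intermediate_co_t_structure T A B A' B'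
      by unfold_locales (use p p' in auto)
    show ?thesis unfolding p' using cotorsion_pair coheart.add_closure_star_A_X
      coheart.add_closure_star_Y_B lperp_Y_SB rperp_A_X by simp
  qed
  have 2: "?\<Psi> q \<in> ?CT \<and> ?\<Phi> (?\<Psi> q) = q" if q: "q \<in> ?CP" for q
  proof -
    obtain X Y where q': "q = (X, Y)" by (cases q)
    interpret cotorsion_pair_in_coheart T A B X Y
      by unfold_locales (use q q' in auto)
    show ?thesis unfolding q' using add_closure_star_A_X add_closure_star_Y_B B_Int_shift_A'
      B'_Int_SSA co_t_structure_A'_B' A_subset_A' A'_subset_SA by simp
  qed
  show ?thesis unfolding Let_def by (rule bij_betw_mutually_inverse) (fact 1, fact 2)
qed

end
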